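(* Let $(S,d_S)$ be a Polish metric space that is isometric to a subset of a Hilbert space, $\Lambda>0$. Let $(X_{t,T})$ be an $S$-valued locally stationary process with auxiliary process $(X_t(u):t\in\mathbb Z,u\in[0,1])$, admitting the representations described in the context, with $\delta_0(m)\to0$ as $m\to\infty$ for both processes. Suppose: (i) $\sup_{T\in\mathbb N}\sup_\lambda\sup_{k\ge0}\sum_{j=0}^\infty\sup_t\nu^W_{t,t-k,T}(j,\lambda)<\infty$ for $W\in\{X,X(\cdot)\}$, where $\nu^W_{t,t-k,T}(j,\lambda)=\sup_{m\ge1}\|P_{t-j}(\mathfrak h(W_{m,t,T},W_{m,t-k,T},\lambda))\|_{\mathbb R,2}$; (ii) for some $\epsilon>0$, $\sup_T\sup_{k\ge0}\sum_{j=0}^\infty j\sup_t\|P_{t-j}(\mathfrak h(X_{t,T},X_{t-k,T},\lambda))\|_{\mathbb R,4+\epsilon}<\infty$; (iii) $h:S\times S\times[0,\Lambda]\to\mathbb R$ is nonnegative, globally bounded, symmetric in its first two arguments, monotone in its third argument, with $|h(x,y,\lambda)-h(x',y,\lambda)|\le L_1d_S(x,x')$ and $|h(x,y,\lambda)-h(x,y,\lambda')|\le L_2(x,y)|\lambda-\lambda'|$, where $\sup_{T}\sup_{1\le t,s\le T}\mathbb E L_2^2(X_{t,T},X_{s,T})<\infty$ and $\sup_{u,v\in[0,1]}\sup_{t,s}\mathbb E L_2^2(X_t(u),X_s(v))<\infty$. Fix $\lambda\in(0,\Lambda]$ with $h(x,y,\lambda)=k(x,y)=e^{-\lambda d_S(x,y)}$,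 and let $\hat\gamma_T^2$ and $Q^\star$ be as defined in the context. Let $(b_T)$ be a sequence of bandwidth parameters such that $b_T\to0$ and $b_TT\to\infty$ as $T\to\infty$. Then $$\Big\{b_T^2\sqrt T\big(\hat\gamma_T^2(u,b_T)-\mathbb E\hat\gamma_T^2(u,b_T)\big):(u,b_T)\in Q^\star\cap(\mathbb R\times\{b_T\})\Big\}\Rightarrow0\qquad(T\to\infty),$$ where the weak convergence is with respect to the Skorokhod metric restricted to $Q^\star\cap(\mathbb R\times\{b_T\})$.
   Context: $Q^\star=\{(u,b)\in\mathbb R^2:0\le u\le1,\ 0\le b\le\min(u,1-u)\}$, and for $(u,b)\in Q^\star$ $$\hat\gamma_T^2(u,b)=\frac1{\lfloor bT\rfloor^2}\Big(\sum_{t,s=\lfloor uT\rfloor-\lfloor bT\rfloor+1}^{\lfloor uT\rfloor}h(X_{t,T},X_{s,T},\lambda)+\sum_{t,s=\lfloor uT\rfloor+1}^{\lfloor uT\rfloor+\lfloor bT\rfloor}h(X_{t,T},X_{s,T},\lambda)-2\sum_{t=\lfloor uT\rfloor-\lfloor bT\rfloor+1}^{\lfloor uT\rfloor}\ \sum_{s=\lfloor uT\rfloor+1}^{\lfloor uT\rfloor+\lfloor bT\rfloor}h(X_{t,T},X_{s,T},\lambda)\Big),$$ with the convention that it is $0$ when the sums are empty. Local stationarity: $(X_{t,T})$ is a triangular array (sample $t=1,\dots,T$, extended by $X_{t,T}=X_{1,T}$ for $t\le0$ and $X_{t,T}=X_{T,T}$ for $t\ge T$) of $S$-valued random variables, and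 it is locally stationary if there is an $S$-valued process $(X_t(u):t\in\mathbb Z,u\in[0,1])$ (the auxiliary process), stationary in $t$ for each fixed $u$, such that $\mathbb E[d_S(X_{t,T},X_t(t/T))\wedge1]=O(T^{-1})$ and $\mathbb E[d_S(X_t(u),X_t(v))\wedge1]=O(|u-v|)$, uniformly in $t=1,\dots,T$ and $u,v\in[0,1]$. Representations: $X_{t,T}=F(t,T,\mathfrak g_t)$ and $X_t(u)=\ddot F(u,\mathfrak g_t)$, where $\mathfrak g_t=(\varepsilon_t,\varepsilon_{t-1},\dots)$ for an iid sequence $(\varepsilon_t)_{t\in\mathbb Z}$ of random elements of a measurable space $\mathfrak G$, and $F:\mathbb Z\times\mathbb N\times\mathfrak G^\infty\to S$, $\ddot F:[0,1]\times\mathfrak G^\infty\to S$ are measurable. Coupling: let $(\varepsilon'_t)$ be an independent copy of $(\varepsilon_t)$. $X_{m,t,T}$ and $X_{m,t}(u)$ are obtained from $X_{t,T}$, $X_t(u)$ by replacing $\mathfrak g_t$ by $(\varepsilon_t,\dots,\varepsilon_{t-m+1},\varepsilon'_{t-m},\varepsilon'_{t-m-1},\dots)$. $\delta_0(m)$ is the supremum of $\mathbb E[d_S(X_{t,T},X_{m,t,T})\wedge1]$ over $t,T$ (respectively of $\mathbb E[d_S(X_t(u),X_{m,t}(u))\wedge1]$ over $t,u$). For $W=X(\cdot)$ in (i), the same quantities are formed from the auxiliary process, $\|P_{t-j}(\mathfrak h(X_{m,t}(u),X_{m,t-k}(v),\lambda))\|_{\mathbb R,2}$, uniformly over $u,v\in[0,1]$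 in place of $T$. $\mathcal G_t=\sigma(\varepsilon_s:s\le t)$, $P_j(Y)=\mathbb E[Y|\mathcal G_j]-\mathbb E[Y|\mathcal G_{j-1}]$, $\|Y\|_{\mathbb R,p}=(\mathbb E|Y|^p)^{1/p}$. $\mathfrak h$ is the demeaned kernel: $\mathfrak h(Y,Z,\lambda)=h(Y,Z,\lambda)-\mathbb E h(Y,Z,\lambda)$ for $S$-valued random variables $Y,Z$. *)

theory Defs
  imports "HOL-Probability.Probability"
begin

subsection \<open>The Skorokhod space of an interval\<close>

text \<open>Functions are extensional outside the index set \<open>I\<close>, so that the distance below
  separates points (see \<open>Metric_space_skorokhod\<close>).\<close>

definition skorokhod_space :: "real set \<Rightarrow> (real \<Rightarrow> real) set" where
  "skorokhod_space I = {x \<in> extensional I. \<forall>t\<in>I.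
      continuous (at t within I \<inter> {t..}) x \<and> (\<exists>l. (x \<longlongrightarrow> l) (at t within I \<inter> {..<t}))}"

definition time_changes :: "real set \<Rightarrow> (real \<Rightarrow> real) set" where
  "time_changes I = {\<rho>. strict_mono_on I \<rho> \<and> continuous_on I \<rho> \<and> \<rho> ` I = I}"

text \<open>The distance is set to \<open>0\<close> off the carrier because \<^locale>\<open>Metric_space\<close> asks for
  nonnegativity and symmetry on the whole type.\<close>

definition skorokhod_dist :: "real set \<Rightarrow> (real \<Rightarrow> real) \<Rightarrow> (real \<Rightarrow> real) \<Rightarrow> real" where
  "skorokhod_dist I x y = (if x \<in> skorokhod_space I \<and> y \<in> skorokhod_space I
     then INF \<rho>\<in>time_changes I. max (SUP t\<in>I. \<bar>\<rho> t - t\<bar>) (SUP t\<in>I. \<bar>x t - y (\<rho> t)\<bar>)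
     else 0)"

lemma skorokhod_bounded:
  assumes x: "x \<in> skorokhod_space {a..b}"
  obtains B where "B \<ge> 0" "\<And>t. t \<in> {a..b} \<Longrightarrow> \<bar>x t\<bar> \<le> B"
proof -
  have loc: "\<exists>U B. open U \<and> t \<in> U \<and> (\<forall>s\<in>U \<inter> {a..b}. \<bar>x s\<bar> \<le> B)" if t: "t \<in> {a..b}" for t
  proof -
    from x t obtain l where c: "(x \<longlongrightarrow> x t) (at t within {a..b} \<inter> {t..})"
      and l: "(x \<longlongrightarrow> l) (at t within {a..b} \<inter> {..<t})"
      unfolding skorokhod_space_def continuous_within by blast
    obtain d1 where d1: "d1 > 0" "\<And>s. s \<in> {a..b} \<inter> {t..} \<Longrightarrow> s \<noteq> t \<Longrightarrow> dist s t < d1 \<Longrightarrow> dist (x s) (x t) < 1"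
      using tendstoD[OF c, of 1] unfolding eventually_at by auto
    obtain d2 where d2: "d2 > 0" "\<And>s. s \<in> {a..b} \<inter> {..<t} \<Longrightarrow> s \<noteq> t \<Longrightarrow> dist s t < d2 \<Longrightarrow> dist (x s) l < 1"
      using tendstoD[OF l, of 1] unfolding eventually_at by auto
    have "\<bar>x s\<bar> \<le> \<bar>x t\<bar> + \<bar>l\<bar> + 1" if s: "s \<in> ball t (min d1 d2) \<inter> {a..b}" for s
    proof -
      have "s = t \<or> dist (x s) (x t) < 1 \<or> dist (x s) l < 1"
        using s d1(2)[of s] d2(2)[of s] by (cases "s < t") (auto simp: dist_commute)
      then show ?thesis by (auto simp: dist_real_def)
    qed
    moreover have "t \<in> ball t (min d1 d2)" using d1 d2 by simp
    ultimately show ?thesis by (intro exI[of _ "ball t (min d1 d2)"]) blast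
  qed
  then obtain U C where U: "\<And>t. t \<in> {a..b} \<Longrightarrow> open (U t) \<and> t \<in> U t \<and> (\<forall>s\<in>U t \<inter> {a..b}. \<bar>x s\<bar> \<le> C t)"
    by metis
  obtain J where J: "J \<subseteq> {a..b}" "finite J" "{a..b} \<subseteq> (\<Union>t\<in>J. U t)"
    using compactE_image[of "{a..b}" "{a..b}" U] U by (metis UN_iff compact_Icc subsetI)
  show thesis
  proof (rule that)
    show "(\<Sum>t\<in>J. \<bar>C t\<bar>) \<ge> 0" by (simp add: sum_nonneg)
    fix s assume s: "s \<in> {a..b}"
    then obtain t where t: "t \<in> J" "s \<in> U t" using J by blast
    then have "\<bar>x s\<bar> \<le> \<bar>C t\<bar>" using U[of t] J s by force
    also have "\<dots> \<le> (\<Sum>t\<in>J. \<bar>C t\<bar>)" using t J by (intro member_le_sum) auto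
    finally show "\<bar>x s\<bar> \<le> (\<Sum>t\<in>J. \<bar>C t\<bar>)" .
  qed
qed

context
  fixes a b :: real
  assumes ab: "a \<le> b"
begin

private abbreviation "cost x y \<rho> \<equiv>
  max (SUP t\<in>{a..b}. \<bar>\<rho> t - t\<bar>) (SUP t\<in>{a..b}. \<bar>x t - y (\<rho> t)\<bar>)"

private lemma tc_in: "\<rho> \<in> time_changes {a..b} \<Longrightarrow> t \<in> {a..b} \<Longrightarrow> \<rho> t \<in> {a..b}"
  unfolding time_changes_def by blast

private lemma id_tc: "(\<lambda>t. t) \<in> time_changes {a..b}"
  by (auto simp: time_changes_def strict_mono_on_def)

private lemma bdds:
  assumes "x \<in> skorokhod_space {a..b}" "y \<in> skorokhod_space {a..b}" "\<rho> \<in> time_changes {a..b}"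
  shows "bdd_above ((\<lambda>t. \<bar>\<rho> t - t\<bar>) ` {a..b})" "bdd_above ((\<lambda>t. \<bar>x t - y (\<rho> t)\<bar>) ` {a..b})"
proof -
  show "bdd_above ((\<lambda>t. \<bar>\<rho> t - t\<bar>) ` {a..b})"
    by (rule bdd_aboveI2[of _ _ "b - a"]) (use tc_in[OF assms(3)] in \<open>fastforce simp: abs_le_iff\<close>)
  obtain B where B: "\<And>t. t \<in> {a..b} \<Longrightarrow> \<bar>x t\<bar> \<le> B" using skorokhod_bounded[OF assms(1)] by metis
  obtain C where C: "\<And>t. t \<in> {a..b} \<Longrightarrow> \<bar>y t\<bar> \<le> C" using skorokhod_bounded[OF assms(2)] by metis
  show "bdd_above ((\<lambda>t. \<bar>x t - y (\<rho> t)\<bar>) ` {a..b})"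
  proof (rule bdd_aboveI2[of _ _ "B + C"])
    fix t assume "t \<in> {a..b}"
    then show "\<bar>x t - y (\<rho> t)\<bar> \<le> B + C"
      using B[of t] C[of "\<rho> t"] tc_in[OF assms(3), of t] by linarith
  qed
qed

private lemma cost_upper:
  assumes "x \<in> skorokhod_space {a..b}" "y \<in> skorokhod_space {a..b}" "\<rho> \<in> time_changes {a..b}"
    "t \<in> {a..b}"
  shows "\<bar>\<rho> t - t\<bar> \<le> cost x y \<rho>" "\<bar>x t - y (\<rho> t)\<bar> \<le> cost x y \<rho>"
  using cSUP_upper[OF assms(4) bdds(1)[OF assms(1-3)]] cSUP_upper[OF assms(4) bdds(2)[OF assms(1-3)]]
  by linarith+

private lemma cost_least:
  assumes "\<And>t. t \<in> {a..b} \<Longrightarrow> \<bar>\<rho> t - t\<bar> \<le> c" "\<And>t. t \<in> {a..b} \<Longrightarrow> \<bar>x t - y (\<rho> t)\<bar> \<le> c"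
  shows "cost x y \<rho> \<le> c"
  using ab assms by (auto intro!: cSUP_least)

private lemma cost_nonneg:
  assumes "x \<in> skorokhod_space {a..b}" "y \<in> skorokhod_space {a..b}" "\<rho> \<in> time_changes {a..b}"
  shows "0 \<le> cost x y \<rho>"
proof -
  have "0 \<le> \<bar>\<rho> a - a\<bar>" by simp
  also have "\<dots> \<le> cost x y \<rho>" using cost_upper(1)[OF assms, of a] ab by simp
  finally show ?thesis .
qed

private lemma dist_le_cost:
  assumes "x \<in> skorokhod_space {a..b}" "y \<in> skorokhod_space {a..b}" "\<rho> \<in> time_changes {a..b}"
  shows "skorokhod_dist {a..b} x y \<le> cost x y \<rho>"
proof -
  have "(INF \<rho>\<in>time_changes {a..b}. cost x y \<rho>) \<le> cost x y \<rho>"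
    by (rule cINF_lower[OF _ assms(3)]) (rule bdd_belowI2[of _ 0], rule cost_nonneg[OF assms(1,2)])
  then show ?thesis using assms(1,2) by (simp add: skorokhod_dist_def)
qed

private lemma dist_approx:
  assumes xy: "x \<in> skorokhod_space {a..b}" "y \<in> skorokhod_space {a..b}"
    and c: "skorokhod_dist {a..b} x y < c"
  obtains \<rho> where "\<rho> \<in> time_changes {a..b}" "cost x y \<rho> < c"
proof -
  have "(INF \<rho>\<in>time_changes {a..b}. cost x y \<rho>) < c" using xy c by (simp add: skorokhod_dist_def)
  from cInf_lessD[OF _ this] show thesis using that id_tc by blast
qed

private lemma dist_nonneg: "0 \<le> skorokhod_dist {a..b} x y"
proof (cases "x \<in> skorokhod_space {a..b} \<and> y \<in> skorokhod_space {a..b}")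
  case True
  then have "0 \<le> (INF \<rho>\<in>time_changes {a..b}. cost x y \<rho>)"
    by (intro cINF_greatest) (use id_tc cost_nonneg in auto)
  with True show ?thesis by (simp add: skorokhod_dist_def)
qed (auto simp: skorokhod_dist_def)

private lemma dist_sym_le:
  assumes x: "x \<in> skorokhod_space {a..b}" and y: "y \<in> skorokhod_space {a..b}"
  shows "skorokhod_dist {a..b} y x \<le> skorokhod_dist {a..b} x y"
proof (rule field_le_epsilon)
  fix e :: real assume "e > 0"
  then obtain \<rho> where \<rho>: "\<rho> \<in> time_changes {a..b}" "cost x y \<rho> < skorokhod_dist {a..b} x y + e"
    using dist_approx[OF x y, of "skorokhod_dist {a..b} x y + e"] by auto
  define \<sigma> where "\<sigma> = the_inv_into {a..b} \<rho>"
  have inj: "inj_on \<rho> {a..b}" and im: "\<rho> ` {a..b} = {a..b}" and sm: "strict_mono_on {a..b} \<rho>"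
    and co: "continuous_on {a..b} \<rho>"
    using \<rho>(1) by (auto simp: time_changes_def intro: strict_mono_on_imp_inj_on)
  have s1: "\<rho> (\<sigma> t) = t" "\<sigma> t \<in> {a..b}" if "t \<in> {a..b}" for t
    using f_the_inv_into_f[OF inj, of t] the_inv_into_into[OF inj, of t "{a..b}"] that im
    unfolding \<sigma>_def by auto
  have s2: "\<sigma> (\<rho> t) = t" if "t \<in> {a..b}" for t
    using the_inv_into_f_f[OF inj that] unfolding \<sigma>_def .
  have "continuous_on {a..b} \<sigma>"
    using continuous_on_inv[OF co compact_Icc, of \<sigma>] s2 im by auto
  moreover have "strict_mono_on {a..b} \<sigma>"
  proof (rule strict_mono_onI)
    fix r s assume rs: "r \<in> {a..b}" "s \<in> {a..b}" "r < s"
    show "\<sigma> r < \<sigma> s"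
    proof (rule ccontr)
      assume "\<not> \<sigma> r < \<sigma> s"
      then have "\<rho> (\<sigma> s) \<le> \<rho> (\<sigma> r)"
        using strict_mono_on_leD[OF sm] s1(2)[OF rs(1)] s1(2)[OF rs(2)] by simp
      then show False using s1(1)[OF rs(1)] s1(1)[OF rs(2)] rs(3) by simp
    qed
  qed
  moreover have "\<sigma> ` {a..b} = {a..b}"
  proof
    show "\<sigma> ` {a..b} \<subseteq> {a..b}" using s1 by blast
    show "{a..b} \<subseteq> \<sigma> ` {a..b}"
    proof
      fix t assume t: "t \<in> {a..b}"
      show "t \<in> \<sigma> ` {a..b}" using s2[OF t] tc_in[OF \<rho>(1) t] by (metis imageI)
    qed
  qed
  ultimately have \<sigma>: "\<sigma> \<in> time_changes {a..b}" by (simp add: time_changes_def)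
  have "cost y x \<sigma> \<le> cost x y \<rho>"
  proof (rule cost_least)
    fix t assume t: "t \<in> {a..b}"
    show "\<bar>\<sigma> t - t\<bar> \<le> cost x y \<rho>" "\<bar>y t - x (\<sigma> t)\<bar> \<le> cost x y \<rho>"
      using cost_upper[OF x y \<rho>(1) s1(2)[OF t]] s1(1)[OF t] by (simp_all add: abs_minus_commute)
  qed
  then show "skorokhod_dist {a..b} y x \<le> skorokhod_dist {a..b} x y + e"
    using dist_le_cost[OF y x \<sigma>] \<rho>(2) by linarith
qed

private lemma dist_triangle_sk:
  assumes x: "x \<in> skorokhod_space {a..b}" and y: "y \<in> skorokhod_space {a..b}"
    and z: "z \<in> skorokhod_space {a..b}"
  shows "skorokhod_dist {a..b} x z \<le> skorokhod_dist {a..b} x y + skorokhod_dist {a..b} y z"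
proof (rule field_le_epsilon)
  fix e :: real assume e: "e > 0"
  obtain \<rho> where \<rho>: "\<rho> \<in> time_changes {a..b}" "cost x y \<rho> < skorokhod_dist {a..b} x y + e/2"
    using dist_approx[OF x y, of "skorokhod_dist {a..b} x y + e/2"] e by auto
  obtain \<sigma> where \<sigma>: "\<sigma> \<in> time_changes {a..b}" "cost y z \<sigma> < skorokhod_dist {a..b} y z + e/2"
    using dist_approx[OF y z, of "skorokhod_dist {a..b} y z + e/2"] e by auto
  have "strict_mono_on {a..b} (\<lambda>t. \<sigma> (\<rho> t))"
    using \<rho>(1) \<sigma>(1) tc_in[OF \<rho>(1)] unfolding time_changes_def strict_mono_on_def by blast
  moreover have "continuous_on {a..b} (\<lambda>t. \<sigma> (\<rho> t))"
    using \<rho>(1) \<sigma>(1) by (auto simp: time_changes_def intro: continuous_on_compose2)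
  moreover have "(\<lambda>t. \<sigma> (\<rho> t)) ` {a..b} = {a..b}"
    using \<rho>(1) \<sigma>(1) image_image[of \<sigma> \<rho> "{a..b}"] by (auto simp: time_changes_def)
  ultimately have tc: "(\<lambda>t. \<sigma> (\<rho> t)) \<in> time_changes {a..b}" by (simp add: time_changes_def)
  have "cost x z (\<lambda>t. \<sigma> (\<rho> t)) \<le> cost x y \<rho> + cost y z \<sigma>"
  proof (rule cost_least)
    fix t assume t: "t \<in> {a..b}"
    note u = cost_upper[OF x y \<rho>(1) t] cost_upper[OF y z \<sigma>(1) tc_in[OF \<rho>(1) t]]
    show "\<bar>\<sigma> (\<rho> t) - t\<bar> \<le> cost x y \<rho> + cost y z \<sigma>" using u(1,3) by linarith
    show "\<bar>x t - z (\<sigma> (\<rho> t))\<bar> \<le> cost x y \<rho> + cost y z \<sigma>" using u(2,4) by linarith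
  qed
  then show "skorokhod_dist {a..b} x z \<le> skorokhod_dist {a..b} x y + skorokhod_dist {a..b} y z + e"
    using dist_le_cost[OF x z tc] \<rho>(2) \<sigma>(2) by linarith
qed

private lemma dist_zero_imp:
  assumes x: "x \<in> skorokhod_space {a..b}" and y: "y \<in> skorokhod_space {a..b}"
    and d0: "skorokhod_dist {a..b} x y = 0" and t: "t \<in> {a..b}"
  shows "x t = y t"
proof -
  have "\<bar>x t - y t\<bar> \<le> 0 + e" if "e > 0" for e
  proof (cases "t = b")
    case True
    obtain \<rho> where \<rho>: "\<rho> \<in> time_changes {a..b}" "cost x y \<rho> < e"
      using dist_approx[OF x y, of e] d0 \<open>e > 0\<close> by auto
    have "\<rho> ` {a..b} = {a..b}" using \<rho>(1) by (simp add: time_changes_def)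
    then have "b \<in> \<rho> ` {a..b}" using ab by simp
    then obtain s where s: "s \<in> {a..b}" "\<rho> s = b" by blast
    have "strict_mono_on {a..b} \<rho>" using \<rho>(1) by (simp add: time_changes_def)
    from strict_mono_on_leD[OF this s(1), of b] have "\<rho> s \<le> \<rho> b" using s(1) ab by simp
    then have "\<rho> b = b" using s(2) tc_in[OF \<rho>(1), of b] ab by simp
    then show ?thesis using cost_upper(2)[OF x y \<rho>(1) t] \<rho>(2) True by auto
  next
    case False
    then have tb: "t < b" using t by auto
    have cx: "(x \<longlongrightarrow> x t) (at t within {a..b} \<inter> {t..})" and cy: "(y \<longlongrightarrow> y t) (at t within {a..b} \<inter> {t..})"
      using x y t unfolding skorokhod_space_def continuous_within by auto
    obtain d1 where d1: "d1 > 0" "\<And>s. s \<in> {a..b} \<inter> {t..} \<Longrightarrow> s \<noteq> t \<Longrightarrow> dist s t < d1 \<Longrightarrow> dist (x s) (x t) < e/3"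
      using tendstoD[OF cx, of "e/3"] \<open>e > 0\<close> unfolding eventually_at by auto
    obtain d2 where d2: "d2 > 0" "\<And>s. s \<in> {a..b} \<inter> {t..} \<Longrightarrow> s \<noteq> t \<Longrightarrow> dist s t < d2 \<Longrightarrow> dist (y s) (y t) < e/3"
      using tendstoD[OF cy, of "e/3"] \<open>e > 0\<close> unfolding eventually_at by auto
    define d where "d = min (min d1 d2) (b - t)"
    have d: "d > 0" "d \<le> d1" "d \<le> d2" "d \<le> b - t" using d1 d2 tb by (auto simp: d_def)
    define s where "s = t + d/2"
    have s: "s \<in> {a..b}" "s > t" using d t by (auto simp: s_def)
    obtain \<rho> where \<rho>: "\<rho> \<in> time_changes {a..b}" "cost x y \<rho> < min (e/3) (d/2)"
      using dist_approx[OF x y, of "min (e/3) (d/2)"] d0 \<open>e > 0\<close> d by auto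
    note u = cost_upper[OF x y \<rho>(1) s(1)]
    have r: "\<rho> s \<in> {a..b}" by (rule tc_in[OF \<rho>(1) s(1)])
    have "\<bar>\<rho> s - s\<bar> < d/2" using u(1) \<rho>(2) by linarith
    then have "t < \<rho> s" "\<rho> s < t + d" unfolding s_def by linarith+
    then have "dist (y (\<rho> s)) (y t) < e/3" using d2(2)[of "\<rho> s"] r d by (auto simp: dist_real_def)
    moreover have "dist (x s) (x t) < e/3" using d1(2)[of s] s d by (auto simp: dist_real_def s_def)
    moreover have "\<bar>x s - y (\<rho> s)\<bar> < e/3" using u(2) \<rho>(2) by linarith
    ultimately show ?thesis unfolding dist_real_def by linarith
  qed
  then have "\<bar>x t - y t\<bar> \<le> 0" by (rule field_le_epsilon)
  then show ?thesis by simp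
qed

lemma Metric_space_skorokhod: "Metric_space (skorokhod_space {a..b}) (skorokhod_dist {a..b})"
proof
  fix x y z
  let ?D = "skorokhod_space {a..b}" and ?d = "skorokhod_dist {a..b}"
  show "0 \<le> ?d x y" by (rule dist_nonneg)
  show "?d x y = ?d y x"
  proof (cases "x \<in> ?D \<and> y \<in> ?D")
    case True
    then show ?thesis using dist_sym_le[of x y] dist_sym_le[of y x] by simp
  qed (auto simp: skorokhod_dist_def)
  assume xy: "x \<in> ?D" "y \<in> ?D"
  show "?d x y = 0 \<longleftrightarrow> x = y"
  proof
    assume "?d x y = 0"
    then have "x t = y t" if "t \<in> {a..b}" for t
      using dist_zero_imp xy that by blast
    moreover have "x \<in> extensional {a..b}" "y \<in> extensional {a..b}"
      using xy by (auto simp: skorokhod_space_def)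
    ultimately show "x = y" by (rule extensionalityI[rotated 2])
  next
    assume "x = y"
    then show "?d x y = 0"
      using dist_le_cost[OF xy(1) xy(1) id_tc] dist_nonneg[of x x] ab by simp
  qed
  assume "z \<in> ?D"
  then show "?d x z \<le> ?d x y + ?d y z" by (rule dist_triangle_sk[OF xy])
qed

end

subsection \<open>Weak convergence in metric spaces that vary along the sequence\<close>

definition metric_borel :: "'a set \<Rightarrow> ('a \<Rightarrow> 'a \<Rightarrow> real) \<Rightarrow> 'a measure" where
  "metric_borel D d = sigma D {U. openin (Metric_space.mtopology D d) U}"

definition bl_dist :: "'a set \<Rightarrow> ('a \<Rightarrow> 'a \<Rightarrow> real) \<Rightarrow> 'a measure \<Rightarrow> 'a measure \<Rightarrow> real" where
  "bl_dist D d \<mu> \<nu> =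
     (SUP f\<in>{f. (\<forall>x\<in>D. \<bar>f x\<bar> \<le> 1) \<and> (\<forall>x\<in>D. \<forall>y\<in>D. \<bar>f x - f y\<bar> \<le> d x y)}.
        \<bar>(\<integral>x. f x \<partial>\<mu>) - (\<integral>x. f x \<partial>\<nu>)\<bar>)"

text \<open>The spaces \<open>(D n, d n)\<close> change with \<open>n\<close>, so there is no common class of bounded continuous
  test functions. Weak convergence to the deterministic points \<open>z n\<close> is convergence of laws in
  the bounded Lipschitz distance, which metrizes weak convergence when the space is a fixed
  separable one.\<close>

definition converges_weakly_to ::
  "'w measure \<Rightarrow> (nat \<Rightarrow> 'a set) \<Rightarrow> (nat \<Rightarrow> 'a \<Rightarrow> 'a \<Rightarrow> real) \<Rightarrow>
     (nat \<Rightarrow> 'w \<Rightarrow> 'a) \<Rightarrow> (nat \<Rightarrow> 'a) \<Rightarrow> bool" where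
  "converges_weakly_to M D d Y z \<longleftrightarrow>
     (\<forall>\<^sub>F n in sequentially. z n \<in> D n \<and> Y n \<in> M \<rightarrow>\<^sub>M metric_borel (D n) (d n)) \<and>
     (\<lambda>n. bl_dist (D n) (d n) (distr M (metric_borel (D n) (d n)) (Y n))
            (return (metric_borel (D n) (d n)) (z n))) \<longlonglongrightarrow> 0"

subsection \<open>Innovations, coupling and projections\<close>

definition iid_sequence :: "'w measure \<Rightarrow> 'g measure \<Rightarrow> (int \<Rightarrow> 'w \<Rightarrow> 'g) \<Rightarrow> bool" where
  "iid_sequence M G \<epsilon> \<longleftrightarrow>
     prob_space.indep_vars M (\<lambda>_. G) \<epsilon> UNIV \<and> (\<forall>s t. distr M G (\<epsilon> s) = distr M G (\<epsilon> t))"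

definition independent_copy ::
  "'w measure \<Rightarrow> 'g measure \<Rightarrow> (int \<Rightarrow> 'w \<Rightarrow> 'g) \<Rightarrow> (int \<Rightarrow> 'w \<Rightarrow> 'g) \<Rightarrow> bool" where
  "independent_copy M G \<epsilon> \<epsilon>' \<longleftrightarrow>
     (let P = PiM UNIV (\<lambda>_. G) in
        prob_space.indep_var M P (\<lambda>\<omega> t. \<epsilon> t \<omega>) P (\<lambda>\<omega> t. \<epsilon>' t \<omega>) \<and>
        distr M P (\<lambda>\<omega> t. \<epsilon>' t \<omega>) = distr M P (\<lambda>\<omega> t. \<epsilon> t \<omega>))"

definition past :: "(int \<Rightarrow> 'w \<Rightarrow> 'g) \<Rightarrow> int \<Rightarrow> 'w \<Rightarrow> nat \<Rightarrow> 'g" where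
  "past \<epsilon> t \<omega> = (\<lambda>i. \<epsilon> (t - int i) \<omega>)"

definition coupled_past ::
  "(int \<Rightarrow> 'w \<Rightarrow> 'g) \<Rightarrow> (int \<Rightarrow> 'w \<Rightarrow> 'g) \<Rightarrow> nat \<Rightarrow> int \<Rightarrow> 'w \<Rightarrow> nat \<Rightarrow> 'g" where
  "coupled_past \<epsilon> \<epsilon>' m t \<omega> = (\<lambda>i. if i < m then \<epsilon> (t - int i) \<omega> else \<epsilon>' (t - int i) \<omega>)"

definition past_sigma :: "'w measure \<Rightarrow> 'g measure \<Rightarrow> (int \<Rightarrow> 'w \<Rightarrow> 'g) \<Rightarrow> int \<Rightarrow> 'w measure" where
  "past_sigma M G \<epsilon> t = sigma (space M) {\<epsilon> s -` A \<inter> space M | s A. s \<le> t \<and> A \<in> sets G}"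

definition proj ::
  "'w measure \<Rightarrow> 'g measure \<Rightarrow> (int \<Rightarrow> 'w \<Rightarrow> 'g) \<Rightarrow> int \<Rightarrow> ('w \<Rightarrow> real) \<Rightarrow> 'w \<Rightarrow> real" where
  "proj M G \<epsilon> j Y = (\<lambda>\<omega>. real_cond_exp M (past_sigma M G \<epsilon> j) Y \<omega>
                         - real_cond_exp M (past_sigma M G \<epsilon> (j - 1)) Y \<omega>)"

definition Lp_norm :: "'w measure \<Rightarrow> real \<Rightarrow> ('w \<Rightarrow> real) \<Rightarrow> ennreal" where
  "Lp_norm M p Y = (let I = \<integral>\<^sup>+\<omega>. ennreal (\<bar>Y \<omega>\<bar> powr p) \<partial>M in
     if I = \<top> then \<top> else ennreal (enn2real I powr (1 / p)))"

definition demeaned ::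
  "'w measure \<Rightarrow> ('s \<Rightarrow> 's \<Rightarrow> real \<Rightarrow> real) \<Rightarrow> real \<Rightarrow> ('w \<Rightarrow> 's) \<Rightarrow> ('w \<Rightarrow> 's) \<Rightarrow> 'w \<Rightarrow> real" where
  "demeaned M h lam Y Z =
     (\<lambda>\<omega>. h (Y \<omega>) (Z \<omega>) lam - (\<integral>\<omega>'. h (Y \<omega>') (Z \<omega>') lam \<partial>M))"

text \<open>\<open>V\<close> and \<open>W\<close> are coupled families, indexed by \<open>m\<close> and time.\<close>

definition nu ::
  "'w measure \<Rightarrow> 'g measure \<Rightarrow> (int \<Rightarrow> 'w \<Rightarrow> 'g) \<Rightarrow> ('s \<Rightarrow> 's \<Rightarrow> real \<Rightarrow> real) \<Rightarrow> real \<Rightarrow>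
     (nat \<Rightarrow> int \<Rightarrow> 'w \<Rightarrow> 's) \<Rightarrow> (nat \<Rightarrow> int \<Rightarrow> 'w \<Rightarrow> 's) \<Rightarrow> int \<Rightarrow> int \<Rightarrow> nat \<Rightarrow> ennreal" where
  "nu M G \<epsilon> h lam V W t s j =
     (SUP m\<in>{1..}. Lp_norm M 2 (proj M G \<epsilon> (t - int j) (demeaned M h lam (V m t) (W m s))))"

subsection \<open>Locally stationary processes\<close>

definition trunc_dist :: "'w measure \<Rightarrow> ('w \<Rightarrow> 's::metric_space) \<Rightarrow> ('w \<Rightarrow> 's) \<Rightarrow> real" where
  "trunc_dist M Y Z = (\<integral>\<omega>. min (dist (Y \<omega>) (Z \<omega>)) 1 \<partial>M)"

definition locally_stationary ::
  "'w measure \<Rightarrow> (int \<Rightarrow> nat \<Rightarrow> 'w \<Rightarrow> 's::metric_space) \<Rightarrow> (int \<Rightarrow> real \<Rightarrow> 'w \<Rightarrow> 's) \<Rightarrow> bool" where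
  "locally_stationary M X Xa \<longleftrightarrow>
     (\<forall>T\<ge>1. \<forall>t. X t T \<in> borel_measurable M) \<and>
     (\<forall>T\<ge>1. (\<forall>t\<le>0. X t T = X 1 T) \<and> (\<forall>t\<ge>int T. X t T = X (int T) T)) \<and>
     (\<forall>t. \<forall>u\<in>{0..1}. Xa t u \<in> borel_measurable M) \<and>
     (\<forall>u\<in>{0..1}. \<forall>r. distr M (PiM UNIV (\<lambda>_. borel)) (\<lambda>\<omega> t. Xa (t + r) u \<omega>) =
                      distr M (PiM UNIV (\<lambda>_. borel)) (\<lambda>\<omega> t. Xa t u \<omega>)) \<and>
     (\<exists>C. \<forall>T\<ge>1. \<forall>t\<in>{1..int T}. trunc_dist M (X t T) (Xa t (of_int t / real T)) \<le> C / real T) \<and>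
     (\<exists>C. \<forall>t\<ge>1. \<forall>u\<in>{0..1}. \<forall>v\<in>{0..1}. trunc_dist M (Xa t u) (Xa t v) \<le> C * \<bar>u - v\<bar>)"

text \<open>The array is only required to be represented inside the sample: the values copied to
  \<open>t \<le> 0\<close> are not functions of the past at time \<open>t\<close>.\<close>

definition represented_by ::
  "'w measure \<Rightarrow> 'g measure \<Rightarrow> (int \<Rightarrow> 'w \<Rightarrow> 'g) \<Rightarrow> (int \<Rightarrow> nat \<Rightarrow> 'w \<Rightarrow> 's::metric_space) \<Rightarrow>
     (int \<Rightarrow> real \<Rightarrow> 'w \<Rightarrow> 's) \<Rightarrow> (int \<Rightarrow> nat \<Rightarrow> (nat \<Rightarrow> 'g) \<Rightarrow> 's) \<Rightarrow>
     (real \<Rightarrow> (nat \<Rightarrow> 'g) \<Rightarrow> 's) \<Rightarrow> bool" where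
  "represented_by M G \<epsilon> X Xa F Fa \<longleftrightarrow>
     (\<forall>t T. F t T \<in> borel_measurable (PiM UNIV (\<lambda>_. G))) \<and>
     (\<lambda>(u, g). Fa u g) \<in>
        borel_measurable (restrict_space borel {0..1} \<Otimes>\<^sub>M PiM UNIV (\<lambda>_. G)) \<and>
     (\<forall>T\<ge>1. \<forall>t\<in>{1..int T}. AE \<omega> in M. X t T \<omega> = F t T (past \<epsilon> t \<omega>)) \<and>
     (\<forall>t. \<forall>u\<in>{0..1}. AE \<omega> in M. Xa t u \<omega> = Fa u (past \<epsilon> t \<omega>))"

definition coupled_array ::
  "(int \<Rightarrow> nat \<Rightarrow> (nat \<Rightarrow> 'g) \<Rightarrow> 's) \<Rightarrow> (int \<Rightarrow> 'w \<Rightarrow> 'g) \<Rightarrow> (int \<Rightarrow> 'w \<Rightarrow> 'g) \<Rightarrow>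
     nat \<Rightarrow> nat \<Rightarrow> int \<Rightarrow> 'w \<Rightarrow> 's" where
  "coupled_array F \<epsilon> \<epsilon>' T m t \<omega> = F t T (coupled_past \<epsilon> \<epsilon>' m t \<omega>)"

definition coupled_aux ::
  "(real \<Rightarrow> (nat \<Rightarrow> 'g) \<Rightarrow> 's) \<Rightarrow> (int \<Rightarrow> 'w \<Rightarrow> 'g) \<Rightarrow> (int \<Rightarrow> 'w \<Rightarrow> 'g) \<Rightarrow>
     real \<Rightarrow> nat \<Rightarrow> int \<Rightarrow> 'w \<Rightarrow> 's" where
  "coupled_aux Fa \<epsilon> \<epsilon>' u m t \<omega> = Fa u (coupled_past \<epsilon> \<epsilon>' m t \<omega>)"

definition delta0_array ::
  "'w measure \<Rightarrow> (int \<Rightarrow> nat \<Rightarrow> (nat \<Rightarrow> 'g) \<Rightarrow> 's::metric_space) \<Rightarrow> (int \<Rightarrow> 'w \<Rightarrow> 'g) \<Rightarrow>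
     (int \<Rightarrow> 'w \<Rightarrow> 'g) \<Rightarrow> (int \<Rightarrow> nat \<Rightarrow> 'w \<Rightarrow> 's) \<Rightarrow> nat \<Rightarrow> real" where
  "delta0_array M F \<epsilon> \<epsilon>' X m =
     (SUP (t, T)\<in>{(t, T). 1 \<le> t \<and> t \<le> int T}. trunc_dist M (X t T) (coupled_array F \<epsilon> \<epsilon>' T m t))"

definition delta0_aux ::
  "'w measure \<Rightarrow> (real \<Rightarrow> (nat \<Rightarrow> 'g) \<Rightarrow> 's::metric_space) \<Rightarrow> (int \<Rightarrow> 'w \<Rightarrow> 'g) \<Rightarrow>
     (int \<Rightarrow> 'w \<Rightarrow> 'g) \<Rightarrow> (int \<Rightarrow> real \<Rightarrow> 'w \<Rightarrow> 's) \<Rightarrow> nat \<Rightarrow> real" where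
  "delta0_aux M Fa \<epsilon> \<epsilon>' Xa m =
     (SUP (t, u)\<in>UNIV \<times> {0..1}. trunc_dist M (Xa t u) (coupled_aux Fa \<epsilon> \<epsilon>' u m t))"

subsection \<open>The statistic\<close>

definition Qstar :: "(real \<times> real) set" where
  "Qstar = {(u, b). 0 \<le> u \<and> u \<le> 1 \<and> 0 \<le> b \<and> b \<le> min u (1 - u)}"

text \<open>Points of the section of \<^const>\<open>Qstar\<close> at height \<open>b\<close> are identified with their first
  coordinate.\<close>

definition Qstar_section :: "real \<Rightarrow> real set" where
  "Qstar_section b = {u. (u, b) \<in> Qstar}"

lemma Qstar_section_eq: "0 \<le> b \<Longrightarrow> Qstar_section b = {b..1 - b}"
  by (auto simp: Qstar_section_def Qstar_def)

text \<open>For \<open>\<lfloor>bT\<rfloor> = 0\<close> this is \<open>0\<close>, by division by zero and empty sums.\<close>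

definition gamma_hat ::
  "('s \<Rightarrow> 's \<Rightarrow> real \<Rightarrow> real) \<Rightarrow> real \<Rightarrow> (int \<Rightarrow> nat \<Rightarrow> 'w \<Rightarrow> 's) \<Rightarrow>
     nat \<Rightarrow> real \<Rightarrow> real \<Rightarrow> 'w \<Rightarrow> real" where
  "gamma_hat h lam X T u b \<omega> =
     (let U = \<lfloor>u * real T\<rfloor>; B = \<lfloor>b * real T\<rfloor>; L = {U - B + 1..U}; R = {U + 1..U + B} in
      1 / (of_int B)\<^sup>2 *
       ((\<Sum>t\<in>L. \<Sum>s\<in>L. h (X t T \<omega>) (X s T \<omega>) lam)
      + (\<Sum>t\<in>R. \<Sum>s\<in>R. h (X t T \<omega>) (X s T \<omega>) lam)
      - 2 * (\<Sum>t\<in>L. \<Sum>s\<in>R. h (X t T \<omega>) (X s T \<omega>) lam)))"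

definition scan_process ::
  "'w measure \<Rightarrow> ('s \<Rightarrow> 's \<Rightarrow> real \<Rightarrow> real) \<Rightarrow> real \<Rightarrow> (int \<Rightarrow> nat \<Rightarrow> 'w \<Rightarrow> 's) \<Rightarrow>
     (nat \<Rightarrow> real) \<Rightarrow> nat \<Rightarrow> 'w \<Rightarrow> real \<Rightarrow> real" where
  "scan_process M h lam X b T \<omega> =
     (\<lambda>u\<in>Qstar_section (b T). (b T)\<^sup>2 * sqrt (real T) *
        (gamma_hat h lam X T u (b T) \<omega> - (\<integral>\<omega>'. gamma_hat h lam X T u (b T) \<omega>' \<partial>M)))"

end

theory Submission
  imports Defs
begin

text \<open>
  The statistic is a combination of sums of the demeaned kernel over at most $N \times N$
  rectangles of index pairs inside the sample, where $N = \lfloor b_T T\rfloor$. Such a rectangle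
  consists of $O(N)$ diagonals, and along the diagonal of lag \<open>k\<close> the sum is a difference of two
  partial sums of the sequence $t \mapsto \mathfrak h(X_{t,T}, X_{t-k,T})$. Hence, simultaneously
  for all \<open>u\<close>, the scan process is bounded by a constant times $b_T^2 \sqrt T / N^2$ times a sum
  of $O(N)$ maxima of partial sums, one for each lag (\<open>rectangle_sum_le_lag_max\<close>). If every such
  maximum has mean $O(\sqrt T)$, uniformly in the lag, the supremum of the process over \<open>u\<close> has mean
  $O(b_T^2 T / N) = O(b_T)$, which tends to zero. The supremum dominates the Skorokhod distance
  to the zero function, and the bounded Lipschitz distance of a law to a point mass is at most the
  mean distance to that point.

  The bound on the maxima is \<open>expected_lag_max_le\<close>. A variable that is known at time \<open>t\<close> is the sum
  of its projections $P_t, P_{t-1}, \ldots, P_{t-J+1}$ and of its conditional mean given the past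
  at time $t - J$. For fixed \<open>j\<close> the projections $P_{t-j}$ form a martingale difference sequence in
  \<open>t\<close>, so Doob's $L^2$ inequality bounds the mean of the maximum of their partial sums by a constant
  times $\sqrt T$ times the largest $L^2$ norm of a projection. The moment condition makes these
  norms summable over $j \ge 1$, and the term with $j = 0$ is bounded because the kernel is
  (\<open>projective_maximal_inequality\<close>).

  The conditional mean given the remote past vanishes in the limit because of the coupling. Replacing
  the innovations up to time $t - m$ by their independent copies makes the kernel independent of the
  past at time $t - m$, and changes it in $L^1$ by at most a multiple of
  $\delta_0(m) + \delta_0(m - k)$ (\<open>demeaned_regular\<close>).
\<close>

section \<open>Maximal inequalities for filtered variables\<close>

text \<open>The pathwise form of Doob's inequality, due to Azema and Yor: $r_n^2 - 2 r_n m_n$ changes by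
  $-2 r_n d_n$ when no new maximum is reached and by less than that otherwise. The cross term
  is then absorbed by $4 r m \le r^2 + 4 m^2$. For a martingale the last sum has mean zero.\<close>

lemma running_max_square_le:
  fixes d :: "nat \<Rightarrow> real"
  defines "m \<equiv> \<lambda>n. \<Sum>i<n. d i" and "r \<equiv> \<lambda>n. Max ((\<lambda>k. \<Sum>i<k. d i) ` {..n})"
  shows "(r n)\<^sup>2 \<le> 4 * (m n)\<^sup>2 - 4 * (\<Sum>i<n. r i * d i)"
proof -
  have r_Suc: "r (Suc n) = max (m (Suc n)) (r n)" for n
    by (simp add: r_def m_def atMost_Suc)
  have azema_yor: "(r n)\<^sup>2 - 2 * r n * m n \<le> - 2 * (\<Sum>i<n. r i * d i)"
  proof (induction n)
    case 0
    then show ?case by (simp add: r_def m_def)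
  next
    case (Suc n)
    have dn: "d n = m (Suc n) - m n" by (simp add: m_def)
    have "(r (Suc n))\<^sup>2 - 2 * r (Suc n) * m (Suc n) \<le> (r n)\<^sup>2 - 2 * r n * m (Suc n)"
    proof (cases "m (Suc n) \<le> r n")
      case False
      have "0 \<le> (m (Suc n) - r n)\<^sup>2" by simp
      then show ?thesis using False by (simp add: r_Suc power2_eq_square algebra_simps)
    qed (simp add: r_Suc max_def)
    also have "\<dots> = (r n)\<^sup>2 - 2 * r n * m n - 2 * (r n * d n)"
      by (simp add: dn algebra_simps)
    finally show ?case using Suc by simp
  qed
  have "0 \<le> (r n - 2 * m n)\<^sup>2" by simp
  then have "4 * (r n * m n) \<le> (r n)\<^sup>2 + 4 * (m n)\<^sup>2"
    by (simp add: power2_eq_square algebra_simps)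
  then show ?thesis using azema_yor by linarith
qed

text \<open>Time is indexed by the integers, since the projections of an observation reach back before the
  start of the sample.\<close>

locale int_filtered_prob_space = prob_space M for M :: "'w measure" +
  fixes A :: "int \<Rightarrow> 'w measure"
  assumes subalgebra: "subalgebra M (A i)"
    and filtration: "i \<le> j \<Longrightarrow> sets (A i) \<subseteq> sets (A j)"
begin

lemma sub_sigma_finite: "sigma_finite_subalgebra M (A i)"
  by (intro finite_measure_subalgebra_is_sigma_finite)
     (simp add: finite_measure_subalgebra_def finite_measure_subalgebra_axioms_def subalgebra
       finite_measure_axioms)

lemma measurable_filtration: "i \<le> j \<Longrightarrow> f \<in> measurable (A i) N \<Longrightarrow> f \<in> measurable (A j) N"
  using subalgebra[of i] subalgebra[of j] filtration[of i j]
  by (auto simp: measurable_def subalgebra_def)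

lemma measurable_whole: "f \<in> measurable (A i) N \<Longrightarrow> f \<in> measurable M N"
  by (rule measurable_from_subalg[OF subalgebra])

lemma integrable_bounded:
  fixes f :: "'w \<Rightarrow> real"
  shows "f \<in> borel_measurable M \<Longrightarrow> AE x in M. \<bar>f x\<bar> \<le> c \<Longrightarrow> integrable M f"
  by (intro integrable_const_bound[where B = c]) auto

abbreviation cond :: "int \<Rightarrow> ('w \<Rightarrow> real) \<Rightarrow> 'w \<Rightarrow> real" where
  "cond i \<equiv> real_cond_exp M (A i)"

abbreviation increment :: "int \<Rightarrow> ('w \<Rightarrow> real) \<Rightarrow> 'w \<Rightarrow> real" where
  "increment i Y \<equiv> \<lambda>x. cond i Y x - cond (i - 1) Y x"

lemma cond_bounded:
  assumes "Y \<in> borel_measurable M" "AE x in M. \<bar>Y x\<bar> \<le> c"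
  shows "AE x in M. \<bar>cond i Y x\<bar> \<le> c"
proof -
  interpret S: sigma_finite_subalgebra M "A i" by (rule sub_sigma_finite)
  have Y: "integrable M Y" by (rule integrable_bounded[OF assms])
  have "AE x in M. cond i Y x \<le> cond i (\<lambda>_. c) x" "AE x in M. cond i (\<lambda>_. - c) x \<le> cond i Y x"
    by (rule S.real_cond_exp_mono; use assms Y in auto)+
  moreover have "AE x in M. cond i (\<lambda>_. c) x = c" "AE x in M. cond i (\<lambda>_. - c) x = - c"
    by (rule S.real_cond_exp_F_meas; simp)+
  ultimately show ?thesis by eventually_elim linarith
qed

lemma cond_L1_contraction:
  assumes Y: "integrable M Y"
  shows "expectation (\<lambda>x. \<bar>cond i Y x\<bar>) \<le> expectation (\<lambda>x. \<bar>Y x\<bar>)"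
proof -
  interpret S: sigma_finite_subalgebra M "A i" by (rule sub_sigma_finite)
  have "AE x in M. cond i Y x \<le> cond i (\<lambda>x. \<bar>Y x\<bar>) x"
    "AE x in M. cond i (\<lambda>x. (- 1) * Y x) x \<le> cond i (\<lambda>x. \<bar>Y x\<bar>) x"
    by (rule S.real_cond_exp_mono; use Y in auto)+
  moreover have "AE x in M. cond i (\<lambda>x. (- 1) * Y x) x = (- 1) * cond i Y x"
    by (rule S.real_cond_exp_cmult[OF Y])
  ultimately have "AE x in M. \<bar>cond i Y x\<bar> \<le> cond i (\<lambda>x. \<bar>Y x\<bar>) x"
    by eventually_elim linarith
  then have "expectation (\<lambda>x. \<bar>cond i Y x\<bar>) \<le> expectation (cond i (\<lambda>x. \<bar>Y x\<bar>))"
    by (intro integral_mono_AE) (use Y S.real_cond_exp_int in auto)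
  also have "\<dots> = expectation (\<lambda>x. \<bar>Y x\<bar>)" by (rule S.real_cond_exp_int) (use Y in auto)
  finally show ?thesis .
qed

lemma increment_bounded:
  assumes "Y \<in> borel_measurable M" "AE x in M. \<bar>Y x\<bar> \<le> c"
  shows "AE x in M. \<bar>increment i Y x\<bar> \<le> 2 * c"
  using cond_bounded[OF assms, of i] cond_bounded[OF assms, of "i - 1"] by eventually_elim linarith

lemma increment_orthogonal:
  assumes Y: "Y \<in> borel_measurable M" "AE x in M. \<bar>Y x\<bar> \<le> c"
    and f: "f \<in> borel_measurable (A (i - 1))" "AE x in M. \<bar>f x\<bar> \<le> c'"
  shows "expectation (\<lambda>x. f x * increment i Y x) = 0"
proof -
  interpret S: sigma_finite_subalgebra M "A i" by (rule sub_sigma_finite)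
  interpret S': sigma_finite_subalgebra M "A (i - 1)" by (rule sub_sigma_finite)
  have fi: "f \<in> borel_measurable (A i)" by (rule measurable_filtration[OF _ f(1)]) simp
  have "AE x in M. \<bar>f x * Y x\<bar> \<le> c' * c"
    using Y(2) f(2) by eventually_elim (simp add: abs_mult mult_mono')
  then have fY: "integrable M (\<lambda>x. f x * Y x)"
    by (intro integrable_bounded) (use Y measurable_whole[OF f(1)] in auto)
  show ?thesis
    using S.real_cond_exp_intg[OF fY fi Y(1)] S'.real_cond_exp_intg[OF fY f(1) Y(1)]
    by (simp add: right_diff_distrib)
qed

text \<open>Doob's $L^2$ inequality, stated with orthogonality to the bounded past in place of the
  martingale property. Orthogonality is used twice: it removes the last sum in
  \<open>running_max_square_le\<close>, and it makes the second moment of the final partial sum additive. The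
  maximum is one-sided and starts at the empty sum, so that it is nonnegative.\<close>

lemma maximal_inequality:
  assumes meas: "\<And>i. d i \<in> borel_measurable (A (s + int i))"
    and bdd: "\<And>i. AE x in M. \<bar>d i x\<bar> \<le> c"
    and orth: "\<And>i f c'. f \<in> borel_measurable (A (s + int i - 1)) \<Longrightarrow> AE x in M. \<bar>f x\<bar> \<le> c'
      \<Longrightarrow> expectation (\<lambda>x. f x * d i x) = 0"
    and var: "\<And>i. expectation (\<lambda>x. (d i x)\<^sup>2) \<le> \<theta>\<^sup>2" and "\<theta> \<ge> 0"
  shows "expectation (\<lambda>x. Max ((\<lambda>k. \<Sum>i<k. d i x) ` {..n})) \<le> 2 * sqrt n * \<theta>"
proof -
  define m where "m = (\<lambda>k x. \<Sum>i<k. d i x)"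
  define r where "r = (\<lambda>k x. Max ((\<lambda>k. m k x) ` {..k}))"
  have m_meas: "m k \<in> borel_measurable (A (s + int k - 1))" for k
    unfolding m_def by (intro borel_measurable_sum measurable_filtration[OF _ meas]) auto
  have r_meas: "r k \<in> borel_measurable (A (s + int k - 1))" for k
    unfolding r_def by (intro borel_measurable_Max measurable_filtration[OF _ m_meas]) auto
  have [measurable]: "d k \<in> borel_measurable M" "m k \<in> borel_measurable M"
    "r k \<in> borel_measurable M" for k
    using measurable_whole[OF meas] measurable_whole[OF m_meas] measurable_whole[OF r_meas] by auto
  have allbdd: "AE x in M. \<forall>i. \<bar>d i x\<bar> \<le> c" using bdd by (simp add: AE_all_countable)
  have m_le: "\<bar>m k x\<bar> \<le> real k * c" if "\<forall>i. \<bar>d i x\<bar> \<le> c" for k x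
  proof -
    have "\<bar>m k x\<bar> \<le> (\<Sum>i<k. \<bar>d i x\<bar>)" unfolding m_def by (rule sum_abs)
    also have "\<dots> \<le> (\<Sum>i<k. c)" by (intro sum_mono) (use that in auto)
    finally show ?thesis by simp
  qed
  have m_bdd: "AE x in M. \<bar>m k x\<bar> \<le> real k * c" for k
    using allbdd by eventually_elim (rule m_le)
  have r_bdd: "AE x in M. \<bar>r k x\<bar> \<le> real k * c" for k
    using allbdd
  proof eventually_elim
    case (elim x)
    have "r k x \<in> (\<lambda>k. m k x) ` {..k}" unfolding r_def by (intro Max_in) auto
    then obtain l where l: "l \<le> k" "r k x = m l x" by auto
    have "0 \<le> c" using elim[rule_format, of 0] by linarith
    then have "real l * c \<le> real k * c" using l by (intro mult_right_mono) auto
    then show ?case using m_le[OF elim, of l] l by linarith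
  qed
  have int_mult: "integrable M (\<lambda>x. f x * g x)"
    if "f \<in> borel_measurable M" "g \<in> borel_measurable M" "AE x in M. \<bar>f x\<bar> \<le> B" "AE x in M. \<bar>g x\<bar> \<le> B'"
    for f g :: "'w \<Rightarrow> real" and B B'
  proof (rule integrable_bounded[where c = "B * B'"])
    show "AE x in M. \<bar>f x * g x\<bar> \<le> B * B'"
      using that(3,4) by eventually_elim (simp add: abs_mult mult_mono')
  qed (use that in auto)
  have int_m2: "integrable M (\<lambda>x. (m k x)\<^sup>2)" for k
    using int_mult[OF _ _ m_bdd m_bdd] by (simp add: power2_eq_square)
  have int_d2: "integrable M (\<lambda>x. (d k x)\<^sup>2)" for k
    using int_mult[OF _ _ bdd bdd] by (simp add: power2_eq_square)
  have int_r2: "integrable M (\<lambda>x. (r k x)\<^sup>2)" for k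
    using int_mult[OF _ _ r_bdd r_bdd] by (simp add: power2_eq_square)
  have int_rd: "integrable M (\<lambda>x. r k x * d k x)" for k
    using int_mult[OF _ _ r_bdd bdd] by simp
  have int_md: "integrable M (\<lambda>x. m k x * d k x)" for k
    using int_mult[OF _ _ m_bdd bdd] by simp
  have m2: "expectation (\<lambda>x. (m k x)\<^sup>2) \<le> real k * \<theta>\<^sup>2" for k
  proof (induction k)
    case 0
    then show ?case by (simp add: m_def)
  next
    case (Suc k)
    have "expectation (\<lambda>x. (m (Suc k) x)\<^sup>2) =
        expectation (\<lambda>x. (m k x)\<^sup>2 + 2 * (m k x * d k x) + (d k x)\<^sup>2)"
      by (rule Bochner_Integration.integral_cong) (simp_all add: m_def power2_eq_square algebra_simps)
    also have "\<dots> = expectation (\<lambda>x. (m k x)\<^sup>2) + 2 * expectation (\<lambda>x. m k x * d k x)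
        + expectation (\<lambda>x. (d k x)\<^sup>2)"
      using int_m2[of k] int_md[of k] int_d2[of k] by simp
    also have "expectation (\<lambda>x. m k x * d k x) = 0" by (rule orth[OF m_meas m_bdd])
    finally show ?case using Suc var[of k] by (simp add: algebra_simps)
  qed
  have "expectation (\<lambda>x. (r n x)\<^sup>2) \<le>
      expectation (\<lambda>x. 4 * (m n x)\<^sup>2 - 4 * (\<Sum>i<n. r i x * d i x))"
    using int_r2 int_m2 int_rd running_max_square_le
    by (intro integral_mono) (auto simp: r_def m_def)
  also have "\<dots> = 4 * expectation (\<lambda>x. (m n x)\<^sup>2) - 4 * (\<Sum>i<n. expectation (\<lambda>x. r i x * d i x))"
    using int_m2 int_rd by simp
  also have "(\<Sum>i<n. expectation (\<lambda>x. r i x * d i x)) = 0"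
    by (intro sum.neutral ballI orth[OF r_meas r_bdd])
  finally have r2: "expectation (\<lambda>x. (r n x)\<^sup>2) \<le> 4 * (real n * \<theta>\<^sup>2)"
    using m2[of n] by linarith
  have "variance (r n) = expectation (\<lambda>x. (r n x)\<^sup>2) - (expectation (r n))\<^sup>2"
    by (intro variance_eq integrable_bounded[OF _ r_bdd] int_r2) auto
  then have "(expectation (r n))\<^sup>2 \<le> (2 * sqrt n * \<theta>)\<^sup>2"
    using variance_positive[of "r n"] r2 by (simp add: power_mult_distrib)
  then have "expectation (r n) \<le> 2 * sqrt n * \<theta>"
    by (rule power2_le_imp_le) (use \<open>\<theta> \<ge> 0\<close> in simp)
  then show ?thesis by (simp add: r_def m_def)
qed

text \<open>The maximal partial sum of each layer $j$ of projections is controlled by Doob's inequality for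
  the layer and for its negative, which accounts for the constant $4 = 2 \cdot 2$. The remainders
  after $J$ layers enter only through the sum of their first absolute moments, for a fixed number of
  terms; hence mere convergence to zero, without a rate, suffices.\<close>

lemma projective_maximal_inequality:
  fixes Y :: "nat \<Rightarrow> 'w \<Rightarrow> real"
  assumes Y: "\<And>i. i < n \<Longrightarrow> Y i \<in> borel_measurable M" "\<And>i. i < n \<Longrightarrow> AE x in M. \<bar>Y i x\<bar> \<le> c"
    and adapted: "\<And>i. i < n \<Longrightarrow> AE x in M. cond (s + int i) (Y i) x = Y i x"
    and var: "\<And>i j. i < n \<Longrightarrow> expectation (\<lambda>x. (increment (s + int i - int j) (Y i) x)\<^sup>2) \<le> (\<theta> j)\<^sup>2"
    and \<theta>: "\<And>j. 0 \<le> \<theta> j" "\<And>J. (\<Sum>j<J. \<theta> j) \<le> K"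
    and regular: "\<And>i. i < n \<Longrightarrow>
      (\<lambda>J. expectation (\<lambda>x. \<bar>cond (s + int i - int J) (Y i) x\<bar>)) \<longlonglongrightarrow> 0"
  shows "expectation (\<lambda>x. Max ((\<lambda>k. \<bar>\<Sum>i<k. Y i x\<bar>) ` {..n})) \<le> 4 * sqrt n * K"
proof -
  define R where "R = (\<lambda>J. \<Sum>i<n. expectation (\<lambda>x. \<bar>cond (s + int i - int J) (Y i) x\<bar>))"
  define d where "d = (\<lambda>j i. if i < n then increment (s + int i - int j) (Y i) else (\<lambda>_. 0))"
  define mx where "mx g = (\<lambda>x. Max ((\<lambda>k. \<Sum>i<k. g i x) ` {..n}))" for g :: "nat \<Rightarrow> 'w \<Rightarrow> real"
  have d_meas: "d j i \<in> borel_measurable (A ((s - int j) + int i))" for i j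
  proof -
    have "increment (s - int j + int i) Y' \<in> borel_measurable (A (s - int j + int i))" for Y'
      by (intro borel_measurable_diff borel_measurable_cond_exp
          measurable_filtration[OF _ borel_measurable_cond_exp]) simp
    moreover have eq: "s + int i - int j = s - int j + int i" by simp
    ultimately show ?thesis unfolding d_def eq by (cases "i < n") simp_all
  qed
  have d_bdd: "AE x in M. \<bar>d j i x\<bar> \<le> \<bar>2 * c\<bar>" for i j
  proof (cases "i < n")
    case True
    show ?thesis using increment_bounded[OF Y(1)[OF True] Y(2)[OF True], of "s + int i - int j"]
      by eventually_elim (simp add: d_def True)
  qed (simp add: d_def)
  have d_orth: "expectation (\<lambda>x. f x * d j i x) = 0"
    if f: "f \<in> borel_measurable (A (s - int j + int i - 1))" "AE x in M. \<bar>f x\<bar> \<le> c'" for f c' i j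
  proof (cases "i < n")
    case True
    have "s + int i - int j - 1 = s - int j + int i - 1" by simp
    then have "f \<in> borel_measurable (A (s + int i - int j - 1))" by (simp only: f(1))
    from increment_orthogonal[OF Y(1)[OF True] Y(2)[OF True] this f(2)]
    show ?thesis by (simp add: d_def True)
  qed (simp add: d_def)
  have d_var: "expectation (\<lambda>x. (d j i x)\<^sup>2) \<le> (\<theta> j)\<^sup>2" for i j
    using var[of i j] by (simp add: d_def)
  have mx_d: "expectation (mx (d j)) \<le> 2 * sqrt n * \<theta> j" for j
    unfolding mx_def by (rule maximal_inequality[OF d_meas d_bdd d_orth d_var \<theta>(1)])
  have mx_md: "expectation (mx (\<lambda>i x. - d j i x)) \<le> 2 * sqrt n * \<theta> j" for j
    unfolding mx_def
  proof (rule maximal_inequality[OF _ _ _ _ \<theta>(1), where c = "\<bar>2 * c\<bar>" and s = "s - int j"])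
    show "(\<lambda>x. - d j i x) \<in> borel_measurable (A (s - int j + int i))" for i
      using d_meas[of j i] by simp
    show "expectation (\<lambda>x. f x * - d j i x) = 0"
      if "f \<in> borel_measurable (A (s - int j + int i - 1))" "AE x in M. \<bar>f x\<bar> \<le> c'" for f c' i
      using d_orth[OF that] by simp
  qed (use d_bdd d_var in auto)
  have [measurable]: "d j i \<in> borel_measurable M" for j i
    by (rule measurable_whole[OF d_meas])
  have [measurable]: "mx g \<in> borel_measurable M" if [measurable]: "\<And>i. g i \<in> borel_measurable M" for g
    unfolding mx_def by (intro borel_measurable_Max) auto
  have mx_int: "integrable M (mx g)"
    if g[measurable]: "\<And>i. g i \<in> borel_measurable M" and b: "\<And>i. AE x in M. \<bar>g i x\<bar> \<le> B" for g B
  proof (rule integrable_bounded[where c = "real n * B"])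
    have "AE x in M. \<forall>i. \<bar>g i x\<bar> \<le> B" using b by (simp add: AE_all_countable)
    then show "AE x in M. \<bar>mx g x\<bar> \<le> real n * B"
    proof eventually_elim
      case (elim x)
      have "mx g x \<in> (\<lambda>k. \<Sum>i<k. g i x) ` {..n}" unfolding mx_def by (intro Max_in) auto
      then obtain l where l: "l \<le> n" "mx g x = (\<Sum>i<l. g i x)" by auto
      have "\<bar>mx g x\<bar> \<le> (\<Sum>i<l. \<bar>g i x\<bar>)" unfolding l(2) by (rule sum_abs)
      also have "\<dots> \<le> (\<Sum>i<n. \<bar>g i x\<bar>)" by (intro sum_mono2) (use l in auto)
      also have "\<dots> \<le> (\<Sum>i<n. B)" by (intro sum_mono) (use elim in auto)
      finally show ?case by simp
    qed
  qed measurable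
  have Y_meas[measurable]: "i < n \<Longrightarrow> Y i \<in> borel_measurable M" for i by (rule Y(1))
  have Y_int: "i < n \<Longrightarrow> integrable M (Y i)" for i by (rule integrable_bounded[OF Y])
  have cond_int: "i < n \<Longrightarrow> integrable M (cond l (Y i))" for i l
    by (rule integrable_bounded[OF _ cond_bounded[OF Y]]) auto
  \<comment> \<open>The number of layers \<open>J\<close> stays free here and is sent to infinity at the end.\<close>
  have bound: "expectation (\<lambda>x. Max ((\<lambda>k. \<bar>\<Sum>i<k. Y i x\<bar>) ` {..n})) \<le> 4 * sqrt n * K + R J" for J
  proof -
    let ?B = "\<lambda>x. (\<Sum>j<J. mx (d j) x + mx (\<lambda>i x. - d j i x) x) +
        (\<Sum>i<n. \<bar>cond (s + int i - int J) (Y i) x\<bar>)"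
    have "AE x in M. \<forall>i\<in>{..<n}. cond (s + int i) (Y i) x = Y i x"
      using adapted by (intro AE_finite_allI) auto
    then have le: "AE x in M. Max ((\<lambda>k. \<bar>\<Sum>i<k. Y i x\<bar>) ` {..n}) \<le> ?B x"
    proof eventually_elim
      case (elim x)
      have tele: "Y i x = (\<Sum>j<J. d j i x) + cond (s + int i - int J) (Y i) x" if "i < n" for i
      proof -
        have "(\<Sum>j<J. d j i x) =
            (\<Sum>j<J. cond (s + int i - int j) (Y i) x - cond (s + int i - int (Suc j)) (Y i) x)"
          by (intro sum.cong) (simp_all add: d_def that algebra_simps)
        also have "\<dots> = cond (s + int i - int 0) (Y i) x - cond (s + int i - int J) (Y i) x"
          by (rule sum_lessThan_telescope')
        finally show ?thesis using elim that by simp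
      qed
      have "\<bar>\<Sum>i<k. Y i x\<bar> \<le> ?B x" if "k \<le> n" for k
      proof -
        have "(\<Sum>i<k. Y i x) = (\<Sum>i<k. (\<Sum>j<J. d j i x) + cond (s + int i - int J) (Y i) x)"
          using that by (intro sum.cong tele) auto
        also have "\<dots> = (\<Sum>j<J. \<Sum>i<k. d j i x) + (\<Sum>i<k. cond (s + int i - int J) (Y i) x)"
          by (simp add: sum.distrib sum.swap[of _ "{..<k}"])
        finally have "\<bar>\<Sum>i<k. Y i x\<bar> \<le> \<bar>\<Sum>j<J. \<Sum>i<k. d j i x\<bar> + \<bar>\<Sum>i<k. cond (s + int i - int J) (Y i) x\<bar>"
          by (simp add: abs_triangle_ineq)
        also have "\<bar>\<Sum>i<k. cond (s + int i - int J) (Y i) x\<bar> \<le> (\<Sum>i<k. \<bar>cond (s + int i - int J) (Y i) x\<bar>)"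
          by (rule sum_abs)
        also have "\<dots> \<le> (\<Sum>i<n. \<bar>cond (s + int i - int J) (Y i) x\<bar>)"
          by (intro sum_mono2) (use that in auto)
        also have "\<bar>\<Sum>j<J. \<Sum>i<k. d j i x\<bar> \<le> (\<Sum>j<J. \<bar>\<Sum>i<k. d j i x\<bar>)" by (rule sum_abs)
        also have "\<dots> \<le> (\<Sum>j<J. mx (d j) x + mx (\<lambda>i x. - d j i x) x)"
        proof (intro sum_mono)
          fix j
          have mem: "(\<Sum>i<l. g i x) \<le> mx g x" if "l \<le> n" for g l
            unfolding mx_def by (intro Max_ge) (use that in auto)
          show "\<bar>\<Sum>i<k. d j i x\<bar> \<le> mx (d j) x + mx (\<lambda>i x. - d j i x) x"
            using mem[OF that, of "d j"] mem[OF that, of "\<lambda>i x. - d j i x"]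
              mem[of 0 "d j"] mem[of 0 "\<lambda>i x. - d j i x"] by (simp add: sum_negf)
        qed
        finally show ?thesis by simp
      qed
      then show ?case by (intro Max.boundedI) auto
    qed
    have int: "integrable M (mx (d j))" "integrable M (mx (\<lambda>i x. - d j i x))" for j
      by (rule mx_int; use d_bdd in auto)+
    have "expectation (\<lambda>x. Max ((\<lambda>k. \<bar>\<Sum>i<k. Y i x\<bar>) ` {..n})) \<le> expectation ?B"
    proof (rule integral_mono_AE[OF _ _ le])
      show B: "integrable M ?B"
        by (intro Bochner_Integration.integrable_add Bochner_Integration.integrable_sum
            integrable_abs int cond_int) auto
      show "integrable M (\<lambda>x. Max ((\<lambda>k. \<bar>\<Sum>i<k. Y i x\<bar>) ` {..n}))"
      proof (rule Bochner_Integration.integrable_bound[OF B])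
        show "(\<lambda>x. Max ((\<lambda>k. \<bar>\<Sum>i<k. Y i x\<bar>) ` {..n})) \<in> borel_measurable M"
          using Y_meas by (intro borel_measurable_Max borel_measurable_abs borel_measurable_sum) auto
        show "AE x in M. norm (Max ((\<lambda>k. \<bar>\<Sum>i<k. Y i x\<bar>) ` {..n})) \<le> norm (?B x)"
          using le
        proof eventually_elim
          case (elim x)
          have "\<bar>\<Sum>i<0. Y i x\<bar> \<le> Max ((\<lambda>k. \<bar>\<Sum>i<k. Y i x\<bar>) ` {..n})"
            by (intro Max_ge image_eqI[where x = 0]) auto
          then show ?case using elim unfolding real_norm_def by linarith
        qed
      qed
    qed
    also have "\<dots> = expectation (\<lambda>x. \<Sum>j<J. mx (d j) x + mx (\<lambda>i x. - d j i x) x) +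
        expectation (\<lambda>x. \<Sum>i<n. \<bar>cond (s + int i - int J) (Y i) x\<bar>)"
      by (intro Bochner_Integration.integral_add Bochner_Integration.integrable_add
          Bochner_Integration.integrable_sum integrable_abs int cond_int) auto
    also have "expectation (\<lambda>x. \<Sum>i<n. \<bar>cond (s + int i - int J) (Y i) x\<bar>) = R J"
      unfolding R_def by (intro Bochner_Integration.integral_sum integrable_abs cond_int) auto
    also have "expectation (\<lambda>x. \<Sum>j<J. mx (d j) x + mx (\<lambda>i x. - d j i x) x) =
        (\<Sum>j<J. expectation (mx (d j)) + expectation (mx (\<lambda>i x. - d j i x)))"
      by (subst Bochner_Integration.integral_sum) (use int in auto)
    also have "(\<Sum>j<J. expectation (mx (d j)) + expectation (mx (\<lambda>i x. - d j i x)))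
        \<le> (\<Sum>j<J. 4 * sqrt n * \<theta> j)"
    proof (intro sum_mono)
      show "expectation (mx (d j)) + expectation (mx (\<lambda>i x. - d j i x)) \<le> 4 * sqrt n * \<theta> j" for j
        using mx_d[of j] mx_md[of j] by linarith
    qed
    also have "\<dots> \<le> 4 * sqrt n * K"
      using \<theta>(2)[of J] by (simp add: sum_distrib_left[symmetric] mult_left_mono)
    finally show ?thesis by simp
  qed
  have "(\<lambda>J. 4 * sqrt n * K + R J) \<longlonglongrightarrow> 4 * sqrt n * K + (\<Sum>i<n. 0)"
    unfolding R_def by (intro tendsto_intros regular) auto
  then show ?thesis
    by (intro LIMSEQ_le_const[of "\<lambda>J. 4 * sqrt n * K + R J"]) (use bound in auto)
qed

lemma cond_independent:
  assumes N: "subalgebra M N" "indep_set (sets (A i)) (sets N)"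
    and Z: "Z \<in> borel_measurable N" "integrable M Z"
  shows "AE x in M. cond i Z x = expectation Z"
proof -
  interpret S: sigma_finite_subalgebra M "A i" by (rule sub_sigma_finite)
  show ?thesis
  proof (rule S.real_cond_exp_charact)
    fix B assume B: "B \<in> sets (A i)"
    have Zm: "Z \<in> borel_measurable M" by (rule measurable_from_subalg[OF N(1) Z(1)])
    have BM: "B \<in> sets M" using B subalgebra[of i] by (auto simp: subalgebra_def)
    have 1: "sigma_sets (space M) {(indicator B :: 'w \<Rightarrow> real) -` C \<inter> space M |C. C \<in> sets borel} \<subseteq> sets (A i)"
    proof -
      have "(indicator B :: 'w \<Rightarrow> real) \<in> borel_measurable (A i)" using B by simp
      then have "(indicator B :: 'w \<Rightarrow> real) -` C \<inter> space M \<in> sets (A i)" if "C \<in> sets borel" for C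
        using that subalgebra[of i] unfolding subalgebra_def by (metis measurable_sets)
      then show ?thesis
        using sets.sigma_sets_subset[of "{(indicator B :: 'w \<Rightarrow> real) -` C \<inter> space M |C. C \<in> sets borel}" "A i"]
          subalgebra[of i] by (auto simp: subalgebra_def)
    qed
    have 2: "sigma_sets (space M) {Z -` C \<inter> space M |C. C \<in> sets borel} \<subseteq> sets N"
    proof -
      have "Z -` C \<inter> space M \<in> sets N" if "C \<in> sets borel" for C
        using that Z(1) N(1) unfolding subalgebra_def by (metis measurable_sets)
      then show ?thesis
        using sets.sigma_sets_subset[of "{Z -` C \<inter> space M |C. C \<in> sets borel}" N] N(1)
        by (auto simp: subalgebra_def)
    qed
    have "indep_var borel (indicator B :: 'w \<Rightarrow> real) borel Z"
      unfolding indep_var_eq indep_sets2_eq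
    proof (intro conjI ballI)
      show "prob (b \<inter> c) = prob b * prob c"
        if "b \<in> sigma_sets (space M) {(indicator B :: 'w \<Rightarrow> real) -` C \<inter> space M |C. C \<in> sets borel}"
          "c \<in> sigma_sets (space M) {Z -` C \<inter> space M |C. C \<in> sets borel}" for b c
        using N(2)[unfolded indep_sets2_eq] subsetD[OF 1 that(1)] subsetD[OF 2 that(2)] by simp
    qed (use BM Zm order_trans[OF 1] order_trans[OF 2] N(1) subalgebra[of i]
      in \<open>simp_all add: subalgebra_def\<close>)
    moreover have "integrable M (indicator B :: 'w \<Rightarrow> real)"
      using BM by (intro integrable_real_indicator) (auto simp: emeasure_eq_measure)
    ultimately have "expectation (\<lambda>x. indicator B x * Z x) = prob B * expectation Z"
      using indep_var_lebesgue_integral[OF _ _ Z(2)] BM by simp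
    then show "(\<integral>x\<in>B. Z x \<partial>M) = (\<integral>x\<in>B. expectation Z \<partial>M)"
      using BM by (simp add: set_lebesgue_integral_def)
  qed (use Z in auto)
qed

text \<open>The approximation error counts twice: once through the conditional mean of $Y - Z$, and once
  because the constant $E Z$ equals $E(Z - Y)$ for a centred \<open>Y\<close>.\<close>

lemma cond_L1_le_independent:
  assumes N: "subalgebra M N" "indep_set (sets (A i)) (sets N)"
    and Z: "Z \<in> borel_measurable N" "integrable M Z"
    and Y: "integrable M Y" "expectation Y = 0"
  shows "expectation (\<lambda>x. \<bar>cond i Y x\<bar>) \<le> 2 * expectation (\<lambda>x. \<bar>Y x - Z x\<bar>)"
proof -
  interpret S: sigma_finite_subalgebra M "A i" by (rule sub_sigma_finite)
  have YZ: "integrable M (\<lambda>x. Y x - Z x)" using Y Z by simp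
  have "AE x in M. \<bar>cond i Y x\<bar> \<le> \<bar>cond i (\<lambda>x. Y x - Z x) x\<bar> + \<bar>expectation Z\<bar>"
    using cond_independent[OF N Z] S.real_cond_exp_diff[OF Y(1) Z(2)]
    by eventually_elim linarith
  then have "expectation (\<lambda>x. \<bar>cond i Y x\<bar>) \<le>
      expectation (\<lambda>x. \<bar>cond i (\<lambda>x. Y x - Z x) x\<bar> + \<bar>expectation Z\<bar>)"
    by (intro integral_mono_AE) (use S.real_cond_exp_int Y YZ in auto)
  also have "\<dots> = expectation (\<lambda>x. \<bar>cond i (\<lambda>x. Y x - Z x) x\<bar>) + \<bar>expectation Z\<bar>"
    using S.real_cond_exp_int(1)[OF YZ] by (simp add: prob_space)
  also have "expectation (\<lambda>x. \<bar>cond i (\<lambda>x. Y x - Z x) x\<bar>) \<le> expectation (\<lambda>x. \<bar>Y x - Z x\<bar>)"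
    by (rule cond_L1_contraction[OF YZ])
  also have "\<bar>expectation Z\<bar> = \<bar>expectation (\<lambda>x. Y x - Z x)\<bar>" using Y Z by simp
  also have "\<dots> \<le> expectation (\<lambda>x. \<bar>Y x - Z x\<bar>)" by (rule integral_abs_bound)
  finally show ?thesis by simp
qed

end


section \<open>Moments of projections\<close>

text \<open>For $a > 0$ and $p \ge 2$ one has $y^2 \le a^2 (1 + (|y| / a)^p)$; integrating with
  \<open>a\<close> slightly above the $L^p$ norm gives the bound. The factor \<open>2\<close> spares the sharp inequality of
  Lyapunov and is harmless for the rate.\<close>

lemma (in prob_space) second_moment_le_Lp_norm:
  assumes f: "f \<in> borel_measurable M" "AE x in M. \<bar>f x\<bar> \<le> c"
    and p: "p \<ge> 2" and \<theta>: "\<theta> \<ge> 0" "Lp_norm M p f \<le> ennreal \<theta>"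
  shows "expectation (\<lambda>x. (f x)\<^sup>2) \<le> 2 * \<theta>\<^sup>2"
proof -
  note [measurable] = f(1)
  define I where "I = expectation (\<lambda>x. \<bar>f x\<bar> powr p)"
  have int_p: "integrable M (\<lambda>x. \<bar>f x\<bar> powr p)"
  proof (rule integrable_const_bound[where B = "\<bar>c\<bar> powr p"])
    show "AE x in M. norm (\<bar>f x\<bar> powr p) \<le> \<bar>c\<bar> powr p"
      using f(2) by eventually_elim (use p in \<open>auto intro!: powr_mono2\<close>)
  qed measurable
  have int_2: "integrable M (\<lambda>x. (f x)\<^sup>2)"
  proof (rule integrable_const_bound[where B = "c\<^sup>2"])
    show "AE x in M. norm ((f x)\<^sup>2) \<le> c\<^sup>2"
      using f(2) by eventually_elim (simp add: abs_le_square_iff[symmetric])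
  qed measurable
  have nn: "(\<integral>\<^sup>+x. ennreal (\<bar>f x\<bar> powr p) \<partial>M) = ennreal I"
    unfolding I_def by (rule nn_integral_eq_integral[OF int_p]) simp
  have I0: "0 \<le> I" by (simp add: I_def)
  have "I powr (1 / p) \<le> \<theta>"
    using \<theta> I0 by (simp add: Lp_norm_def Let_def nn)
  then have I: "I \<le> a powr p" if "a > \<theta>" for a
  proof -
    have "(I powr (1 / p)) powr p \<le> a powr p"
      using that \<open>I powr (1 / p) \<le> \<theta>\<close> p by (intro powr_mono2) auto
    then show ?thesis using p I0 by (simp add: powr_powr)
  qed
  have "sqrt (expectation (\<lambda>x. (f x)\<^sup>2) / 2) \<le> a" if a: "a > \<theta>" for a
  proof -
    have a0: "a > 0" using a \<theta> by simp
    have le: "y\<^sup>2 \<le> a\<^sup>2 + a\<^sup>2 / a powr p * \<bar>y\<bar> powr p" for y :: real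
    proof (cases "\<bar>y\<bar> \<le> a")
      case True
      then have "y\<^sup>2 \<le> a\<^sup>2" using a0 by (simp add: abs_le_square_iff[symmetric])
      then show ?thesis by (smt (verit) a0 divide_nonneg_nonneg mult_nonneg_nonneg powr_ge_zero zero_le_power2)
    next
      case False
      then have "1 \<le> \<bar>y\<bar> / a" using a0 by simp
      then have "(\<bar>y\<bar> / a) powr 2 \<le> (\<bar>y\<bar> / a) powr p" by (intro powr_mono p)
      moreover have "(\<bar>y\<bar> / a) powr 2 = y\<^sup>2 / a\<^sup>2"
        using a0 False by (simp add: powr_numeral power_divide)
      moreover have "(\<bar>y\<bar> / a) powr p = \<bar>y\<bar> powr p / a powr p"
        using a0 by (simp add: powr_divide)
      ultimately have "y\<^sup>2 / a\<^sup>2 \<le> \<bar>y\<bar> powr p / a powr p" by simp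
      then have "y\<^sup>2 \<le> a\<^sup>2 / a powr p * \<bar>y\<bar> powr p" using a0 by (simp add: field_simps)
      then show ?thesis by (smt (verit) zero_le_power2)
    qed
    have "expectation (\<lambda>x. (f x)\<^sup>2) \<le> expectation (\<lambda>x. a\<^sup>2 + a\<^sup>2 / a powr p * \<bar>f x\<bar> powr p)"
      by (intro integral_mono) (use int_2 int_p le in auto)
    also have "\<dots> = a\<^sup>2 + a\<^sup>2 / a powr p * I" using int_p by (simp add: I_def prob_space)
    also have "\<dots> \<le> a\<^sup>2 + a\<^sup>2 / a powr p * a powr p"
      using I[OF a] a0 by (intro add_left_mono mult_left_mono) auto
    also have "\<dots> = 2 * a\<^sup>2" using a0 by simp
    finally have "expectation (\<lambda>x. (f x)\<^sup>2) / 2 \<le> a\<^sup>2" by simp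
    then show ?thesis using a0 by (intro real_le_lsqrt) auto
  qed
  then have "sqrt (expectation (\<lambda>x. (f x)\<^sup>2) / 2) \<le> \<theta>" by (rule dense_ge)
  then have "expectation (\<lambda>x. (f x)\<^sup>2) / 2 \<le> \<theta>\<^sup>2" by (rule sqrt_le_D)
  then show ?thesis by simp
qed

section \<open>Independence of the past from the future and the copy\<close>

lemma (in prob_space) past_sigma_filtration:
  assumes \<epsilon>: "\<And>s. \<epsilon> s \<in> measurable M G"
  shows "int_filtered_prob_space M (past_sigma M G \<epsilon>)"
proof
  show "subalgebra M (past_sigma M G \<epsilon> i)" for i
  proof -
    have "{\<epsilon> s -` A \<inter> space M |s A. s \<le> i \<and> A \<in> sets G} \<subseteq> sets M"
      using measurable_sets[OF \<epsilon>] by auto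
    then show ?thesis
      unfolding subalgebra_def past_sigma_def
      using sets.space_closed[of M] by (simp add: sets.sigma_sets_subset subset_trans)
  qed
  show "sets (past_sigma M G \<epsilon> i) \<subseteq> sets (past_sigma M G \<epsilon> j)" if "i \<le> j" for i j
    unfolding past_sigma_def
    by (subst (1 2) sets_measure_of, blast, blast, intro sigma_sets_mono') (use that in fastforce)
qed

text \<open>Besides the innovations after time \<open>r\<close>, this contains the whole independent copy: it carries
  every observation whose innovations up to time \<open>r\<close> have been replaced.\<close>

definition future_sigma ::
  "'w measure \<Rightarrow> 'g measure \<Rightarrow> (int \<Rightarrow> 'w \<Rightarrow> 'g) \<Rightarrow> (int \<Rightarrow> 'w \<Rightarrow> 'g) \<Rightarrow> int \<Rightarrow> 'w measure" where
  "future_sigma M G \<epsilon> \<epsilon>' r = sigma (space M)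
     ({\<epsilon> s -` A \<inter> space M | s A. r < s \<and> A \<in> sets G} \<union>
      {(\<lambda>\<omega> t. \<epsilon>' t \<omega>) -` B \<inter> space M | B. B \<in> sets (PiM UNIV (\<lambda>_. G))})"

lemma space_future_sigma [simp]: "space (future_sigma M G \<epsilon> \<epsilon>' r) = space M"
  by (simp add: future_sigma_def space_measure_of_conv)

lemma sets_future_sigma:
  "sets (future_sigma M G \<epsilon> \<epsilon>' r) = sigma_sets (space M)
     ({\<epsilon> s -` A \<inter> space M | s A. r < s \<and> A \<in> sets G} \<union>
      {(\<lambda>\<omega> t. \<epsilon>' t \<omega>) -` B \<inter> space M | B. B \<in> sets (PiM UNIV (\<lambda>_. G))})"
  unfolding future_sigma_def by (rule sets_measure_of) blast

text \<open>The innovations and the copy, taken as one single block, form an independent family of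
  \<open>\<sigma>\<close>-algebras (index \<open>None\<close> for the copy); the claim regroups this family.\<close>

lemma (in prob_space) past_indep_future_and_copy:
  assumes iid: "iid_sequence M G \<epsilon>" and copy: "independent_copy M G \<epsilon> \<epsilon>'"
  shows "indep_set (sets (past_sigma M G \<epsilon> r)) (sets (future_sigma M G \<epsilon> \<epsilon>' r))"
proof -
  let ?P = "PiM UNIV (\<lambda>_. G) :: (int \<Rightarrow> 'b) measure"
  let ?s = "\<lambda>\<omega> t. \<epsilon> t \<omega>" and ?s' = "\<lambda>\<omega> t. \<epsilon>' t \<omega>"
  define E where "E = (\<lambda>i. case i of None \<Rightarrow> {?s' -` B \<inter> space M | B. B \<in> sets ?P}
     | Some s \<Rightarrow> {\<epsilon> s -` B \<inter> space M | B. B \<in> sets G})"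
  have ind: "indep_sets (\<lambda>s. {\<epsilon> s -` B \<inter> space M | B. B \<in> sets G}) UNIV"
    and \<epsilon>: "\<epsilon> s \<in> measurable M G" for s
    using iid by (auto simp: iid_sequence_def indep_vars_def2)
  have cop: "indep_var ?P ?s ?P ?s'" using copy by (simp add: independent_copy_def Let_def)
  have s': "?s' \<in> measurable M ?P" and s: "?s \<in> measurable M ?P"
    using cop unfolding indep_var_eq by auto
  have cop': "prob ((?s -` B \<inter> space M) \<inter> (?s' -` C \<inter> space M)) = prob (?s -` B \<inter> space M) * prob (?s' -` C \<inter> space M)"
    if "B \<in> sets ?P" "C \<in> sets ?P" for B C
    using cop that unfolding indep_var_eq indep_sets2_eq by (blast intro: sigma_sets.Basic)
  have "indep_sets E UNIV"
  proof (rule indep_setsI)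
    show "E i \<subseteq> events" for i
      using measurable_sets[OF s'] measurable_sets[OF \<epsilon>] by (auto simp: E_def split: option.splits)
    fix B J assume J: "J \<noteq> {}" "finite J" "\<forall>j\<in>J. B j \<in> E j"
    define K where "K = {s. Some s \<in> J}"
    have K: "finite K" using J(2) unfolding K_def by (rule finite_vimageI[of J Some, unfolded vimage_def]) simp
    have BK: "\<forall>s\<in>K. B (Some s) \<in> {\<epsilon> s -` B \<inter> space M | B. B \<in> sets G}"
      using J(3) by (auto simp: K_def E_def)
    have prodK: "prob (\<Inter>s\<in>K. B (Some s)) = (\<Prod>s\<in>K. prob (B (Some s)))" if "K \<noteq> {}"
      by (rule indep_setsD[OF ind]) (use K that BK in auto)
    show "prob (\<Inter>j\<in>J. B j) = (\<Prod>j\<in>J. prob (B j))"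
    proof (cases "None \<in> J")
      case False
      then have JK: "J = Some ` K" by (auto simp: K_def image_iff) (metis not_None_eq)
      then have "K \<noteq> {}" using J by auto
      from prodK[OF this] show ?thesis by (simp add: JK prod.reindex image_image)
    next
      case True
      then have JK: "J = insert None (Some ` K)" by (auto simp: K_def image_iff) (metis not_None_eq)
      obtain C where C: "C \<in> sets ?P" "B None = ?s' -` C \<inter> space M" using bspec[OF J(3) True] by (auto simp: E_def)
      show ?thesis
      proof (cases "K = {}")
        case False
        obtain D where D: "\<And>s. s \<in> K \<Longrightarrow> D s \<in> sets G" "\<And>s. s \<in> K \<Longrightarrow> B (Some s) = \<epsilon> s -` D s \<inter> space M"
          using BK by simp metis
        let ?D = "\<Inter>s\<in>K. (\<lambda>x. x s) -` D s \<inter> space ?P"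
        have "?D \<in> sets ?P"
          by (intro sets.finite_INT K False measurable_sets[OF measurable_component_singleton] D) auto
        moreover have "(\<Inter>s\<in>K. B (Some s)) = ?s -` ?D \<inter> space M"
          using D False measurable_space[OF s] by auto
        ultimately have "prob ((\<Inter>s\<in>K. B (Some s)) \<inter> B None) = prob (\<Inter>s\<in>K. B (Some s)) * prob (B None)"
          using cop'[of ?D C] C by simp
        then show ?thesis using prodK[OF False] K
          by (simp add: JK prod.reindex image_image Int_commute mult.commute)
      qed (simp add: JK)
    qed
  qed
  moreover define I where "I = case_bool (Some ` {..r}) (insert None (Some ` {r<..}))"
  ultimately have "indep_sets (\<lambda>j. sigma_sets (space M) (\<Union>i\<in>I j. E i)) UNIV"
  proof (intro indep_sets_collect_sigma)
    show "indep_sets E (\<Union>j\<in>UNIV. I j)" by (rule indep_sets_mono_index[OF _ \<open>indep_sets E UNIV\<close>]) simp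
    have stable: "Int_stable {f -` B \<inter> space M | B. B \<in> sets N}" for f :: "'a \<Rightarrow> 'c" and N
    proof (rule Int_stableI, clarsimp)
      fix B C assume "B \<in> sets N" "C \<in> sets N"
      then show "\<exists>D. f -` B \<inter> space M \<inter> (f -` C \<inter> space M) = f -` D \<inter> space M \<and> D \<in> sets N"
        by (intro exI[of _ "B \<inter> C"]) auto
    qed
    show "Int_stable (E i)" for i
      by (cases i) (simp_all add: E_def stable)
    show "disjoint_family_on I UNIV"
      by (auto simp: disjoint_family_on_def I_def split: bool.splits)
  qed
  moreover have "(\<lambda>j. sigma_sets (space M) (\<Union>i\<in>I j. E i)) =
      case_bool (sets (past_sigma M G \<epsilon> r)) (sets (future_sigma M G \<epsilon> \<epsilon>' r))"
  proof
    have 1: "(\<Union>i\<in>Some ` {..r}. E i) = {\<epsilon> s -` A \<inter> space M | s A. s \<le> r \<and> A \<in> sets G}"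
      by (auto simp: E_def)
    have 2: "(\<Union>i\<in>insert None (Some ` {r<..}). E i) =
      {\<epsilon> s -` A \<inter> space M | s A. r < s \<and> A \<in> sets G} \<union> {?s' -` B \<inter> space M | B. B \<in> sets ?P}"
      by (auto simp: E_def)
    have 3: "sets (past_sigma M G \<epsilon> r) = sigma_sets (space M) {\<epsilon> s -` A \<inter> space M | s A. s \<le> r \<and> A \<in> sets G}"
      unfolding past_sigma_def by (rule sets_measure_of) blast
    fix j show "sigma_sets (space M) (\<Union>i\<in>I j. E i) =
        case_bool (sets (past_sigma M G \<epsilon> r)) (sets (future_sigma M G \<epsilon> \<epsilon>' r)) j"
      by (cases j) (simp_all only: I_def bool.case 1 2 3 sets_future_sigma)
  qed
  ultimately show ?thesis unfolding indep_set_def by simp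
qed

lemma (in prob_space) future_sigma_subalgebra:
  assumes \<epsilon>: "\<And>s. \<epsilon> s \<in> measurable M G" and \<epsilon>': "(\<lambda>\<omega> t. \<epsilon>' t \<omega>) \<in> measurable M (PiM UNIV (\<lambda>_. G))"
  shows "subalgebra M (future_sigma M G \<epsilon> \<epsilon>' r)"
proof -
  have "{\<epsilon> s -` A \<inter> space M | s A. r < s \<and> A \<in> sets G} \<union>
      {(\<lambda>\<omega> t. \<epsilon>' t \<omega>) -` B \<inter> space M | B. B \<in> sets (PiM UNIV (\<lambda>_. G))} \<subseteq> sets M"
    using measurable_sets[OF \<epsilon>] measurable_sets[OF \<epsilon>'] by blast
  then show ?thesis
    unfolding subalgebra_def sets_future_sigma by (simp add: sets.sigma_sets_subset)
qed

lemma coupled_past_measurable: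
  assumes \<epsilon>: "\<And>s. \<epsilon> s \<in> measurable M G" and \<epsilon>': "(\<lambda>\<omega> t. \<epsilon>' t \<omega>) \<in> measurable M (PiM UNIV (\<lambda>_. G))"
    and r: "r \<le> t - int m"
  shows "coupled_past \<epsilon> \<epsilon>' m t \<in> measurable (future_sigma M G \<epsilon> \<epsilon>' r) (PiM UNIV (\<lambda>_. G))"
proof -
  let ?N = "future_sigma M G \<epsilon> \<epsilon>' r"
  have 1: "\<epsilon> s \<in> measurable ?N G" if "r < s" for s
  proof (rule measurableI)
    show "\<epsilon> s -` A \<inter> space ?N \<in> sets ?N" if "A \<in> sets G" for A
      unfolding sets_future_sigma space_future_sigma using that \<open>r < s\<close> by blast
  qed (use measurable_space[OF \<epsilon>] in simp)
  have "(\<lambda>\<omega> t. \<epsilon>' t \<omega>) \<in> measurable ?N (PiM UNIV (\<lambda>_. G))"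
  proof (rule measurableI)
    show "(\<lambda>\<omega> t. \<epsilon>' t \<omega>) -` B \<inter> space ?N \<in> sets ?N" if "B \<in> sets (PiM UNIV (\<lambda>_. G))" for B
      unfolding sets_future_sigma space_future_sigma using that by blast
  qed (use measurable_space[OF \<epsilon>'] in simp)
  from measurable_compose[OF this measurable_component_singleton]
  have 2: "\<epsilon>' s \<in> measurable ?N G" for s by simp
  show ?thesis
    unfolding coupled_past_def
  proof (rule measurable_PiM_single')
    show "(\<lambda>\<omega>. if i < m then \<epsilon> (t - int i) \<omega> else \<epsilon>' (t - int i) \<omega>) \<in> measurable ?N G" for i
      using 1[of "t - int i"] 2 r by (cases "i < m") simp_all
    show "(\<lambda>\<omega> i. if i < m then \<epsilon> (t - int i) \<omega> else \<epsilon>' (t - int i) \<omega>) \<in> space ?N \<rightarrow> (UNIV \<rightarrow>\<^sub>E space G)"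
      using measurable_space[OF \<epsilon>] measurable_space[OF 2] by (auto simp: PiE_def)
  qed
qed

section \<open>The demeaned kernel along the array\<close>

text \<open>The kernel is Lipschitz with constant \<open>lam\<close> and has range in $[0, 1]$; together these turn the
  truncated distances of the coupling into a bound on the kernel.\<close>

lemma exp_kernel_coupling:
  fixes x y x' y' :: "'a::metric_space"
  assumes "lam \<ge> 0"
  shows "\<bar>exp (- lam * dist x y) - exp (- lam * dist x' y')\<bar>
    \<le> (1 + lam) * (min (dist x x') 1 + min (dist y y') 1)"
proof -
  have lip: "\<bar>exp (- a) - exp (- b)\<bar> \<le> \<bar>a - b\<bar> \<and> \<bar>exp (- a) - exp (- b)\<bar> \<le> 1"
    if "0 \<le> a" "0 \<le> b" for a b :: real
  proof -
    have *: "exp (- a) - exp (- b) \<le> b - a \<and> exp (- a) \<ge> exp (- b) \<and> exp (- a) - exp (- b) \<le> 1"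
      if "0 \<le> a" "a \<le> b" for a b :: real
    proof -
      have "exp (- a) - exp (- b) = exp (- a) * (1 - exp (a - b))"
        by (simp add: right_diff_distrib exp_add[symmetric])
      also have "\<dots> \<le> 1 * (1 - exp (a - b))" using that by (intro mult_right_mono) auto
      also have "\<dots> \<le> b - a" using exp_ge_add_one_self[of "a - b"]
        by (simp only: mult_1_left)
      finally show ?thesis using that by (smt (verit) exp_ge_zero exp_le_cancel_iff exp_le_one_iff)
    qed
    show ?thesis using *[of a b] *[of b a] that by (cases "a \<le> b") auto
  qed
  let ?L = "\<bar>exp (- lam * dist x y) - exp (- lam * dist x' y')\<bar>"
  have L: "?L \<le> \<bar>lam * dist x y - lam * dist x' y'\<bar>" "?L \<le> 1"
    using lip[of "lam * dist x y" "lam * dist x' y'"] assms by simp_all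
  show ?thesis
  proof (cases "dist x x' \<le> 1 \<and> dist y y' \<le> 1")
    case True
    have "\<bar>dist x y - dist x' y'\<bar> \<le> dist x x' + dist y y'"
      by (smt (verit) dist_commute dist_triangle)
    then have "lam * \<bar>dist x y - dist x' y'\<bar> \<le> (1 + lam) * (dist x x' + dist y y')"
      using assms by (intro mult_mono) auto
    moreover have "\<bar>lam * dist x y - lam * dist x' y'\<bar> = lam * \<bar>dist x y - dist x' y'\<bar>"
      using assms by (simp add: right_diff_distrib[symmetric] abs_mult)
    ultimately show ?thesis using True L by simp
  next
    case False
    then have "1 * 1 \<le> (1 + lam) * (min (dist x x') 1 + min (dist y y') 1)"
      using assms by (intro mult_mono) (auto simp: min_def)
    then show ?thesis using L by simp
  qed
qed

lemma (in prob_space) past_measurable: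
  assumes \<epsilon>: "\<And>s. \<epsilon> s \<in> measurable M G"
  shows "past \<epsilon> t \<in> measurable (past_sigma M G \<epsilon> t) (PiM UNIV (\<lambda>_. G))"
proof -
  let ?N = "past_sigma M G \<epsilon> t"
  have sp: "space ?N = space M" by (simp add: past_sigma_def space_measure_of_conv)
  have sts: "sets ?N = sigma_sets (space M) {\<epsilon> s -` A \<inter> space M | s A. s \<le> t \<and> A \<in> sets G}"
    unfolding past_sigma_def by (rule sets_measure_of) blast
  have \<epsilon>': "\<epsilon> s \<in> measurable ?N G" if "s \<le> t" for s
  proof (rule measurableI)
    show "\<epsilon> s -` A \<inter> space ?N \<in> sets ?N" if "A \<in> sets G" for A
      unfolding sp sts using that \<open>s \<le> t\<close> by blast
  qed (use measurable_space[OF \<epsilon>] sp in simp)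
  show ?thesis
    unfolding past_def
  proof (rule measurable_PiM_single')
    show "\<epsilon> (t - int i) \<in> measurable ?N G" for i by (rule \<epsilon>') simp
    show "(\<lambda>\<omega> i. \<epsilon> (t - int i) \<omega>) \<in> space ?N \<rightarrow> (UNIV \<rightarrow>\<^sub>E space G)"
      using measurable_space[OF \<epsilon>] by (auto simp: PiE_def sp)
  qed
qed

lemma (in prob_space) demeaned_adapted:
  fixes X :: "int \<Rightarrow> nat \<Rightarrow> 'a \<Rightarrow> 's::polish_space"
  assumes \<epsilon>: "\<And>s. \<epsilon> s \<in> measurable M G"
    and rep: "represented_by M G \<epsilon> X Xa F Fa" and X: "\<And>s. X s T \<in> borel_measurable M"
    and h: "\<And>x y. h x y lam = exp (- lam * dist x y)" and lam: "lam \<ge> 0"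
    and t: "T \<ge> 1" "int k + 1 \<le> t" "t \<le> int T"
  defines "Y \<equiv> demeaned M h lam (X t T) (X (t - int k) T)"
  shows "AE x in M. real_cond_exp M (past_sigma M G \<epsilon> t) Y x = Y x"
proof -
  interpret filt: int_filtered_prob_space M "past_sigma M G \<epsilon>" by (rule past_sigma_filtration[OF \<epsilon>])
  interpret S: sigma_finite_subalgebra M "past_sigma M G \<epsilon> t" by (rule filt.sub_sigma_finite)
  define c where "c = expectation (\<lambda>\<omega>. h (X t T \<omega>) (X (t - int k) T \<omega>) lam)"
  define Z where "Z = (\<lambda>\<omega>. exp (- lam * dist (F t T (past \<epsilon> t \<omega>)) (F (t - int k) T (past \<epsilon> (t - int k) \<omega>))) - c)"
  have F: "(\<lambda>\<omega>. F s T (past \<epsilon> s \<omega>)) \<in> borel_measurable (past_sigma M G \<epsilon> t)" if "s \<le> t" for s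
    by (rule filt.measurable_filtration[OF that], rule measurable_compose[OF past_measurable[OF \<epsilon>]])
       (use rep in \<open>auto simp: represented_by_def\<close>)
  have [measurable]: "Z \<in> borel_measurable (past_sigma M G \<epsilon> t)"
    unfolding Z_def using F[of t] F[of "t - int k"] by measurable
  have Zm: "Z \<in> borel_measurable M" by (rule filt.measurable_whole) measurable
  have Ym: "Y \<in> borel_measurable M"
    unfolding Y_def demeaned_def h using X[of t] X[of "t - int k"] by measurable
  have "AE x in M. X t T x = F t T (past \<epsilon> t x)" "AE x in M. X (t - int k) T x = F (t - int k) T (past \<epsilon> (t - int k) x)"
    using rep t unfolding represented_by_def by auto
  then have YZ: "AE x in M. Y x = Z x"
    by eventually_elim (simp add: Y_def Z_def demeaned_def c_def h)
  have "integrable M Z"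
  proof (rule filt.integrable_bounded[where c = "1 + \<bar>c\<bar>", OF Zm])
    show "AE x in M. \<bar>Z x\<bar> \<le> 1 + \<bar>c\<bar>"
    proof (rule AE_I2)
      fix x
      have "0 \<le> exp (- lam * dist y z) \<and> exp (- lam * dist y z) \<le> 1" for y z :: 's
        using lam by (simp add: mult_nonneg_nonneg)
      then show "\<bar>Z x\<bar> \<le> 1 + \<bar>c\<bar>" unfolding Z_def by (smt (verit))
    qed
  qed
  then have "AE x in M. real_cond_exp M (past_sigma M G \<epsilon> t) Z x = Z x"
    by (rule S.real_cond_exp_F_meas) measurable
  with YZ S.real_cond_exp_cong[OF YZ Ym Zm] show ?thesis by eventually_elim simp
qed

text \<open>Replacing the innovations up to time $t - m$ means coupling the observation at time \<open>t\<close> after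
  \<open>m\<close> steps, but the one at the earlier time $t - k$ after only $m - k$ steps.\<close>

lemma (in prob_space) demeaned_regular:
  fixes X :: "int \<Rightarrow> nat \<Rightarrow> 'a \<Rightarrow> 's::polish_space"
  assumes iid: "iid_sequence M G \<epsilon>" and copy: "independent_copy M G \<epsilon> \<epsilon>'"
    and rep: "represented_by M G \<epsilon> X Xa F Fa" and X: "\<And>s T. T \<ge> 1 \<Longrightarrow> X s T \<in> borel_measurable M"
    and \<delta>: "delta0_array M F \<epsilon> \<epsilon>' X \<longlonglongrightarrow> 0"
    and h: "\<And>x y. h x y lam = exp (- lam * dist x y)" and lam: "lam \<ge> 0"
    and t: "T \<ge> 1" "int k + 1 \<le> t" "t \<le> int T"
  defines "Y \<equiv> demeaned M h lam (X t T) (X (t - int k) T)"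
  shows "(\<lambda>J. expectation (\<lambda>x. \<bar>real_cond_exp M (past_sigma M G \<epsilon> (t - int J)) Y x\<bar>)) \<longlonglongrightarrow> 0"
proof -
  have \<epsilon>: "\<epsilon> s \<in> measurable M G" for s using iid by (auto simp: iid_sequence_def indep_vars_def2)
  have \<epsilon>': "(\<lambda>\<omega> t. \<epsilon>' t \<omega>) \<in> measurable M (PiM UNIV (\<lambda>_. G))"
    using copy by (simp add: independent_copy_def Let_def indep_var_eq)
  interpret filt: int_filtered_prob_space M "past_sigma M G \<epsilon>" by (rule past_sigma_filtration[OF \<epsilon>])
  let ?\<delta> = "delta0_array M F \<epsilon> \<epsilon>' X"
  note sub = future_sigma_subalgebra[where \<epsilon> = \<epsilon> and G = G, OF \<epsilon> \<epsilon>']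
  have C_fut: "coupled_array F \<epsilon> \<epsilon>' T' m s \<in> borel_measurable (future_sigma M G \<epsilon> \<epsilon>' r)"
    if "r \<le> s - int m" for T' m s r
  proof -
    have "(\<lambda>\<omega>. F s T' (coupled_past \<epsilon> \<epsilon>' m s \<omega>)) \<in> borel_measurable (future_sigma M G \<epsilon> \<epsilon>' r)"
      by (rule measurable_compose[OF coupled_past_measurable[OF \<epsilon> \<epsilon>' that]])
         (use rep in \<open>auto simp: represented_by_def\<close>)
    then show ?thesis by (simp add: coupled_array_def[abs_def])
  qed
  have C: "coupled_array F \<epsilon> \<epsilon>' T' m s \<in> borel_measurable M" for T' m s
    by (rule measurable_from_subalg[OF sub C_fut[OF order_refl]])
  have kern: "0 \<le> exp (- lam * dist y z) \<and> exp (- lam * dist y z) \<le> 1" for y z :: 's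
    using lam by simp
  have exp_meas: "(\<lambda>\<omega>. exp (- lam * dist (f \<omega>) (g \<omega>))) \<in> borel_measurable N"
    if [measurable]: "f \<in> borel_measurable N" "g \<in> borel_measurable N" for f g :: "'a \<Rightarrow> 's" and N
    by measurable
  have td_int: "integrable M (\<lambda>\<omega>. min (dist (X s T \<omega>) (coupled_array F \<epsilon> \<epsilon>' T m s \<omega>)) 1)" if "T \<ge> 1" for s T m
    by (rule filt.integrable_bounded[where c = 1])
       (intro borel_measurable_min borel_measurable_dist X[OF that] C borel_measurable_const, simp)
  have td_le: "trunc_dist M (X s T) (coupled_array F \<epsilon> \<epsilon>' T m s) \<le> ?\<delta> m"
    if "1 \<le> s" "s \<le> int T" for s m
    unfolding delta0_array_def
  proof (rule cSUP_upper2[where x = "(s, T)"])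
    show "bdd_above ((\<lambda>(t, T). trunc_dist M (X t T) (coupled_array F \<epsilon> \<epsilon>' T m t)) ` {(t, T). 1 \<le> t \<and> t \<le> int T})"
    proof (rule bdd_aboveI2[where M = 1], clarify)
      fix t' :: int and T' assume "1 \<le> t'" "t' \<le> int T'"
      then have "T' \<ge> 1" by simp
      then have "trunc_dist M (X t' T') (coupled_array F \<epsilon> \<epsilon>' T' m t') \<le> expectation (\<lambda>_. 1)"
        unfolding trunc_dist_def by (intro integral_mono td_int) auto
      then show "trunc_dist M (X t' T') (coupled_array F \<epsilon> \<epsilon>' T' m t') \<le> 1"
        by (simp add: prob_space)
    qed
  qed (use that in auto)
  define c where "c = expectation (\<lambda>\<omega>. h (X t T \<omega>) (X (t - int k) T \<omega>) lam)"
  note Xm = X[OF t(1)]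
  have Ydef: "Y = (\<lambda>\<omega>. exp (- lam * dist (X t T \<omega>) (X (t - int k) T \<omega>)) - c)"
    by (simp add: Y_def demeaned_def c_def h)
  have int_e: "integrable M (\<lambda>\<omega>. exp (- lam * dist (f \<omega>) (g \<omega>)))"
    if "f \<in> borel_measurable M" "g \<in> borel_measurable M" for f g :: "'a \<Rightarrow> 's"
    by (rule filt.integrable_bounded[where c = 1, OF exp_meas[OF that]]) (use kern in \<open>simp add: abs_le_iff\<close>)
  have Yint: "integrable M Y" unfolding Ydef using int_e[OF Xm Xm] by simp
  have Y0: "expectation Y = 0"
    unfolding Ydef using int_e[OF Xm Xm] by (simp add: prob_space c_def h)
  have bound: "expectation (\<lambda>x. \<bar>real_cond_exp M (past_sigma M G \<epsilon> (t - int m)) Y x\<bar>)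
      \<le> 2 * (1 + lam) * (?\<delta> m + ?\<delta> (m - k))" if m: "m \<ge> k" for m
  proof -
    let ?U = "coupled_array F \<epsilon> \<epsilon>' T m t" and ?V = "coupled_array F \<epsilon> \<epsilon>' T (m - k) (t - int k)"
    define Z where "Z = (\<lambda>\<omega>. exp (- lam * dist (?U \<omega>) (?V \<omega>)) - c)"
    have "?U \<in> borel_measurable (future_sigma M G \<epsilon> \<epsilon>' (t - int m))"
      "?V \<in> borel_measurable (future_sigma M G \<epsilon> \<epsilon>' (t - int m))"
      by (rule C_fut; use m in \<open>simp add: of_nat_diff\<close>)+
    from exp_meas[OF this] have Zm: "Z \<in> borel_measurable (future_sigma M G \<epsilon> \<epsilon>' (t - int m))"
      unfolding Z_def by measurable
    have Zint: "integrable M Z" unfolding Z_def using int_e[OF C C] by simp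
    have "expectation (\<lambda>x. \<bar>real_cond_exp M (past_sigma M G \<epsilon> (t - int m)) Y x\<bar>)
        \<le> 2 * expectation (\<lambda>x. \<bar>Y x - Z x\<bar>)"
      by (rule filt.cond_L1_le_independent[OF sub past_indep_future_and_copy[OF iid copy] Zm Zint Yint Y0])
    also have "expectation (\<lambda>x. \<bar>Y x - Z x\<bar>) \<le> expectation (\<lambda>x. (1 + lam) *
        (min (dist (X t T x) (?U x)) 1 + min (dist (X (t - int k) T x) (?V x)) 1))"
    proof (rule integral_mono)
      show "integrable M (\<lambda>x. \<bar>Y x - Z x\<bar>)" using Yint Zint by simp
      show "integrable M (\<lambda>x. (1 + lam) *
          (min (dist (X t T x) (?U x)) 1 + min (dist (X (t - int k) T x) (?V x)) 1))"
        using td_int[OF t(1)] by simp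
      show "\<bar>Y x - Z x\<bar> \<le> (1 + lam) *
          (min (dist (X t T x) (?U x)) 1 + min (dist (X (t - int k) T x) (?V x)) 1)" for x
        using exp_kernel_coupling[OF lam, of "X t T x" "X (t - int k) T x" "?U x" "?V x"]
        by (simp add: Ydef Z_def)
    qed
    also have "\<dots> = (1 + lam) * (trunc_dist M (X t T) ?U + trunc_dist M (X (t - int k) T) ?V)"
      using td_int[OF t(1)] by (simp add: trunc_dist_def)
    also have "\<dots> \<le> (1 + lam) * (?\<delta> m + ?\<delta> (m - k))"
      using t lam by (intro mult_left_mono add_mono td_le) auto
    finally show ?thesis by (simp only: mult.assoc)
  qed
  have lim: "(\<lambda>m. 2 * (1 + lam) * (?\<delta> m + ?\<delta> (m - k))) \<longlonglongrightarrow> 2 * (1 + lam) * (0 + 0)"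
  proof (intro tendsto_intros \<delta>)
    show "(\<lambda>m. ?\<delta> (m - k)) \<longlonglongrightarrow> 0"
      by (rule LIMSEQ_offset[where k = k]) (use \<delta> in simp)
  qed
  show ?thesis
  proof (rule tendsto_sandwich[OF _ _ tendsto_const])
    show "\<forall>\<^sub>F m in sequentially. expectation (\<lambda>x. \<bar>real_cond_exp M (past_sigma M G \<epsilon> (t - int m)) Y x\<bar>)
      \<le> 2 * (1 + lam) * (?\<delta> m + ?\<delta> (m - k))"
      using bound unfolding eventually_sequentially by blast
    show "(\<lambda>m. 2 * (1 + lam) * (?\<delta> m + ?\<delta> (m - k))) \<longlonglongrightarrow> 0" using lim by simp
  qed simp
qed

section \<open>Sums over rectangles of index pairs\<close>

text \<open>Partial sums run along the diagonal of lag \<open>k\<close> inside the square $\{1, \ldots, T\}^2$, which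
  that diagonal enters at $(k + 1, 1)$ and leaves at $(T, T - k)$. For $k \ge T$ only the empty sum is left.\<close>

definition lag_max :: "(int \<Rightarrow> int \<Rightarrow> real) \<Rightarrow> nat \<Rightarrow> nat \<Rightarrow> real" where
  "lag_max D T k = Max ((\<lambda>n. \<bar>\<Sum>i<n. D (int k + 1 + int i) (1 + int i)\<bar>) ` {..T - k})"

lemma lag_max_nonneg: "0 \<le> lag_max D T k"
proof -
  have "0 \<le> \<bar>\<Sum>i<0. D (int k + 1 + int i) (1 + int i)\<bar>" by simp
  also have "\<dots> \<le> lag_max D T k"
    unfolding lag_max_def by (intro Max_ge image_eqI[where x = 0]) auto
  finally show ?thesis .
qed

lemma diagonal_window_le_lag_max:
  assumes "int k + 1 \<le> p" "q \<le> int T"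
  shows "\<bar>\<Sum>t\<in>{p..q}. D t (t - int k)\<bar> \<le> 2 * lag_max D T k"
proof (cases "p \<le> q")
  case True
  have initial: "\<bar>\<Sum>t\<in>{int k + 1..r}. D t (t - int k)\<bar> \<le> lag_max D T k" if "int k \<le> r" "r \<le> int T" for r
  proof -
    have "(\<Sum>t\<in>{int k + 1..r}. D t (t - int k)) = (\<Sum>i<nat (r - int k). D (int k + 1 + int i) (1 + int i))"
      by (rule sum.reindex_bij_witness[of _ "\<lambda>i. int k + 1 + int i" "\<lambda>t. nat (t - int k - 1)"])
         (use that in \<open>auto simp: algebra_simps\<close>)
    moreover have "nat (r - int k) \<le> T - k" using that by linarith
    ultimately show ?thesis unfolding lag_max_def by (intro Max_ge) auto
  qed
  have "(\<Sum>t\<in>{int k + 1..q}. D t (t - int k)) =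
      (\<Sum>t\<in>{int k + 1..p - 1}. D t (t - int k)) + (\<Sum>t\<in>{p..q}. D t (t - int k))"
    by (subst sum.union_disjoint[symmetric]) (use assms True in \<open>auto intro!: sum.cong\<close>)
  then show ?thesis using initial[of q] initial[of "p - 1"] assms True by linarith
qed (use lag_max_nonneg[of D T k] in simp)

lemma diagonal_of_rectangle:
  fixes D :: "int \<Rightarrow> int \<Rightarrow> real"
  shows "(\<Sum>(t, s)\<in>{x \<in> {a + 1..a + N} \<times> {c + 1..c + N}. fst x - snd x = e}. D t s) =
    (\<Sum>t\<in>{max a (c + e) + 1..min (a + N) (c + N + e)}. D t (t - e))"
  by (rule sum.reindex_bij_witness[of _ "\<lambda>t. (t, t - e)" fst]) (auto split: prod.splits)

text \<open>Any finite set \<open>E\<close> of lags that covers the rectangle is admitted, so that rectangles in different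
  positions can be bounded by the same sum.\<close>

lemma rectangle_sum_le_lag_max:
  fixes D :: "int \<Rightarrow> int \<Rightarrow> real"
  assumes sym: "\<And>t s. D t s = D s t"
    and a: "0 \<le> a" "a + N \<le> int T" and c: "0 \<le> c" "c + N \<le> int T"
    and E: "finite E" "{a - c - N..a - c + N} \<subseteq> E"
  shows "\<bar>\<Sum>t\<in>{a + 1..a + N}. \<Sum>s\<in>{c + 1..c + N}. D t s\<bar> \<le> 2 * (\<Sum>e\<in>E. lag_max D T (nat \<bar>e\<bar>))"
proof -
  let ?R = "{a + 1..a + N} \<times> {c + 1..c + N}"
  have "(\<Sum>t\<in>{a + 1..a + N}. \<Sum>s\<in>{c + 1..c + N}. D t s) = (\<Sum>(t, s)\<in>?R. D t s)"
    by (rule sum.cartesian_product)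
  also have "\<dots> = (\<Sum>e\<in>E. \<Sum>(t, s)\<in>{x \<in> ?R. fst x - snd x = e}. D t s)"
    by (rule sum.group[symmetric]) (use E in auto)
  finally have "\<bar>\<Sum>t\<in>{a + 1..a + N}. \<Sum>s\<in>{c + 1..c + N}. D t s\<bar>
      \<le> (\<Sum>e\<in>E. \<bar>\<Sum>(t, s)\<in>{x \<in> ?R. fst x - snd x = e}. D t s\<bar>)"
    by (simp add: sum_abs)
  also have "\<dots> \<le> (\<Sum>e\<in>E. 2 * lag_max D T (nat \<bar>e\<bar>))"
  proof (rule sum_mono)
    fix e
    show "\<bar>\<Sum>(t, s)\<in>{x \<in> ?R. fst x - snd x = e}. D t s\<bar> \<le> 2 * lag_max D T (nat \<bar>e\<bar>)"
    proof (cases "0 \<le> e")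
      case True
      then show ?thesis
        using diagonal_window_le_lag_max[of "nat e" "max a (c + e) + 1" "min (a + N) (c + N + e)" T D] a c
        by (simp add: diagonal_of_rectangle)
    next
      case False
      \<comment> \<open>A diagonal below the main one is a diagonal above it after transposing the rectangle.\<close>
      have "(\<Sum>(t, s)\<in>{x \<in> ?R. fst x - snd x = e}. D t s) =
          (\<Sum>(t, s)\<in>{x \<in> {c + 1..c + N} \<times> {a + 1..a + N}. fst x - snd x = - e}. D t s)"
        by (rule sum.reindex_bij_witness[of _ prod.swap prod.swap]) (auto simp: sym)
      then show ?thesis
        using diagonal_window_le_lag_max[of "nat (- e)" "max c (a - e) + 1" "min (c + N) (a + N - e)" T D]
          a c False by (simp add: diagonal_of_rectangle)
    qed
  qed
  finally show ?thesis by (simp add: sum_distrib_left)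
qed

section \<open>Step functions in the Skorokhod space\<close>

text \<open>The identity is an admissible time change.\<close>

lemma skorokhod_dist_le_sup_dist:
  assumes ab: "a \<le> b" and xy: "x \<in> skorokhod_space {a..b}" "y \<in> skorokhod_space {a..b}"
    and c: "\<And>t. t \<in> {a..b} \<Longrightarrow> \<bar>x t - y t\<bar> \<le> c"
  shows "skorokhod_dist {a..b} x y \<le> c"
proof -
  let ?cost = "\<lambda>\<rho>. max (SUP t\<in>{a..b}. \<bar>\<rho> t - t\<bar>) (SUP t\<in>{a..b}. \<bar>x t - y (\<rho> t)\<bar>)"
  have id: "(\<lambda>t. t) \<in> time_changes {a..b}"
    by (auto simp: time_changes_def strict_mono_on_def)
  have "0 \<le> ?cost \<rho>" if \<rho>: "\<rho> \<in> time_changes {a..b}" for \<rho>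
  proof -
    have "\<rho> t \<in> {a..b}" if "t \<in> {a..b}" for t
      using \<rho> that unfolding time_changes_def by blast
    then have "bdd_above ((\<lambda>t. \<bar>\<rho> t - t\<bar>) ` {a..b})"
      by (intro bdd_aboveI2[where M = "b - a"]) (fastforce simp: abs_le_iff)
    then have "\<bar>\<rho> a - a\<bar> \<le> (SUP t\<in>{a..b}. \<bar>\<rho> t - t\<bar>)" using ab by (intro cSUP_upper) auto
    then show ?thesis by simp
  qed
  then have "bdd_below (?cost ` time_changes {a..b})" by (rule bdd_belowI2)
  from cINF_lower[OF this id]
  have "skorokhod_dist {a..b} x y \<le> max (SUP t\<in>{a..b}. \<bar>t - t\<bar>) (SUP t\<in>{a..b}. \<bar>x t - y t\<bar>)"
    using xy by (simp add: skorokhod_dist_def)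
  also have "\<dots> \<le> c"
    using c[of a] ab by (auto intro!: cSUP_least c)
  finally show ?thesis .
qed

text \<open>The scan process depends on its location only through $\lfloor u T\rfloor$. Hence its paths are
  step functions, determined by finitely many of the values \<open>v\<close>.\<close>

definition floor_step :: "real \<Rightarrow> real set \<Rightarrow> (int \<Rightarrow> real) \<Rightarrow> real \<Rightarrow> real" where
  "floor_step T I v = (\<lambda>u\<in>I. v \<lfloor>u * T\<rfloor>)"

lemma floor_step_skorokhod:
  assumes T: "T > 0"
  shows "floor_step T I v \<in> skorokhod_space I"
proof -
  have "continuous (at t within I \<inter> {t..}) (floor_step T I v)" if t: "t \<in> I" for t
  proof -
    have "t < (of_int \<lfloor>t * T\<rfloor> + 1) / T" using T by (simp add: pos_less_divide_eq)
    then have "\<forall>\<^sub>F s in at t within I \<inter> {t..}. s < (of_int \<lfloor>t * T\<rfloor> + 1) / T"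
      by (rule order_tendstoD[OF tendsto_ident_at])
    moreover have "\<forall>\<^sub>F s in at t within I \<inter> {t..}. s \<in> I \<inter> {t..}"
      by (simp add: eventually_at_filter)
    ultimately have "\<forall>\<^sub>F s in at t within I \<inter> {t..}. floor_step T I v s = floor_step T I v t"
    proof eventually_elim
      case (elim s)
      have "s * T < of_int \<lfloor>t * T\<rfloor> + 1" using elim T by (simp add: pos_less_divide_eq)
      moreover have "t * T \<le> s * T" using elim T by simp
      ultimately have "\<lfloor>s * T\<rfloor> = \<lfloor>t * T\<rfloor>" by linarith
      then show ?case using elim t by (simp add: floor_step_def)
    qed
    then show ?thesis unfolding continuous_within by (rule tendsto_eventually)
  qed
  moreover have "\<exists>l. (floor_step T I v \<longlongrightarrow> l) (at t within I \<inter> {..<t})" for t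
  proof
    have "(of_int \<lceil>t * T\<rceil> - 1) / T < t"
      using T by (simp add: pos_divide_less_eq) linarith
    then have "\<forall>\<^sub>F s in at t within I \<inter> {..<t}. (of_int \<lceil>t * T\<rceil> - 1) / T < s"
      by (rule order_tendstoD[OF tendsto_ident_at])
    moreover have "\<forall>\<^sub>F s in at t within I \<inter> {..<t}. s \<in> I \<inter> {..<t}"
      by (simp add: eventually_at_filter)
    ultimately have "\<forall>\<^sub>F s in at t within I \<inter> {..<t}. floor_step T I v s = v (\<lceil>t * T\<rceil> - 1)"
    proof eventually_elim
      case (elim s)
      have "of_int \<lceil>t * T\<rceil> - 1 < s * T" using elim T by (simp add: pos_divide_less_eq)
      moreover have "s * T < t * T" using elim T by simp
      ultimately have "\<lfloor>s * T\<rfloor> = \<lceil>t * T\<rceil> - 1" by linarith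
      then show ?case using elim by (simp add: floor_step_def)
    qed
    then show "(floor_step T I v \<longlongrightarrow> v (\<lceil>t * T\<rceil> - 1)) (at t within I \<inter> {..<t})"
      by (rule tendsto_eventually)
  qed
  ultimately show ?thesis by (simp add: skorokhod_space_def floor_step_def)
qed

text \<open>The path depends continuously on the coordinates in the product topology, since only finitely
  many of them occur and the uniform distance dominates the Skorokhod distance. Preimages of open
  sets are therefore open in a countable product of lines, where Borel measurability is
  coordinatewise.\<close>

lemma floor_step_measurable:
  assumes ab: "a \<le> b" and T: "T > 0" and V: "\<And>i. (\<lambda>\<omega>. V \<omega> i) \<in> borel_measurable M"
  shows "(\<lambda>\<omega>. floor_step T {a..b} (V \<omega>)) \<in>
    M \<rightarrow>\<^sub>M metric_borel (skorokhod_space {a..b}) (skorokhod_dist {a..b})"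
proof -
  interpret Metric_space "skorokhod_space {a..b}" "skorokhod_dist {a..b}"
    by (rule Metric_space_skorokhod[OF ab])
  have Vm: "V \<in> borel_measurable M" by (rule measurable_coordinatewise_then_product[OF V])
  show ?thesis
    unfolding metric_borel_def
  proof (rule measurable_measure_of)
    show "{U. openin mtopology U} \<subseteq> Pow (skorokhod_space {a..b})"
      using openin_subset by fastforce
    show "(\<lambda>\<omega>. floor_step T {a..b} (V \<omega>)) \<in> space M \<rightarrow> skorokhod_space {a..b}"
      using floor_step_skorokhod[OF T] by blast
    fix U assume "U \<in> {U. openin mtopology U}"
    then have U: "openin mtopology U" by simp
    have "open {v. floor_step T {a..b} v \<in> U}"
    proof (subst open_subopen, safe)
      fix v assume v: "floor_step T {a..b} v \<in> U"
      obtain r where r: "r > 0" "mball (floor_step T {a..b} v) r \<subseteq> U"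
        using U v by (auto simp: openin_mtopology)
      define W where "W = (\<Inter>i\<in>{\<lfloor>a * T\<rfloor>..\<lfloor>b * T\<rfloor>}. {w. \<bar>w i - v i\<bar> < r / 2})"
      have "open W"
        unfolding W_def by (intro open_INT finite_atLeastAtMost_int ballI open_Collect_less
            continuous_intros continuous_on_product_coordinates)
      moreover have "v \<in> W" using r by (simp add: W_def)
      moreover have "W \<subseteq> {v. floor_step T {a..b} v \<in> U}"
      proof safe
        fix w assume w: "w \<in> W"
        have "skorokhod_dist {a..b} (floor_step T {a..b} v) (floor_step T {a..b} w) \<le> r / 2"
        proof (rule skorokhod_dist_le_sup_dist[OF ab floor_step_skorokhod[OF T] floor_step_skorokhod[OF T]])
          fix t assume t: "t \<in> {a..b}"
          then have "\<lfloor>t * T\<rfloor> \<in> {\<lfloor>a * T\<rfloor>..\<lfloor>b * T\<rfloor>}" using T by (auto intro!: floor_mono mult_right_mono)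
          then have "\<bar>w \<lfloor>t * T\<rfloor> - v \<lfloor>t * T\<rfloor>\<bar> < r / 2" using w unfolding W_def by blast
          then show "\<bar>floor_step T {a..b} v t - floor_step T {a..b} w t\<bar> \<le> r / 2"
            using t by (simp add: floor_step_def abs_minus_commute)
        qed
        then have "floor_step T {a..b} w \<in> mball (floor_step T {a..b} v) r"
          using r floor_step_skorokhod[OF T] by (simp add: in_mball)
        then show "floor_step T {a..b} w \<in> U" using r by blast
      qed
      ultimately show "\<exists>W. open W \<and> v \<in> W \<and> W \<subseteq> {v. floor_step T {a..b} v \<in> U}" by blast
    qed
    then have "V -` {v. floor_step T {a..b} v \<in> U} \<inter> space M \<in> sets M"
      by (intro measurable_sets[OF Vm] borel_open)
    then show "(\<lambda>\<omega>. floor_step T {a..b} (V \<omega>)) -` U \<inter> space M \<in> sets M"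
      by (simp add: vimage_def)
  qed
qed

text \<open>A Lipschitz test function moves by at most the distance. Nonnegativity is part of the claim
  because the distance is a supremum of reals: it needs a bounded set of test values, and the
  zero function is one of the test functions.\<close>

lemma (in prob_space) bl_dist_return_le:
  assumes "Metric_space D d" and Y: "Y \<in> M \<rightarrow>\<^sub>M metric_borel D d" and z: "z \<in> D"
    and R: "integrable M R" "\<And>\<omega>. \<omega> \<in> space M \<Longrightarrow> d (Y \<omega>) z \<le> R \<omega>"
  shows "bl_dist D d (distr M (metric_borel D d) Y) (return (metric_borel D d) z) \<in> {0..expectation R}"
proof -
  interpret Metric_space D d by fact
  let ?N = "metric_borel D d"
  let ?C = "{f. (\<forall>x\<in>D. \<bar>f x\<bar> \<le> 1) \<and> (\<forall>x\<in>D. \<forall>y\<in>D. \<bar>f x - f y\<bar> \<le> d x y)} :: ('b \<Rightarrow> real) set"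
  have sub: "{U. openin mtopology U} \<subseteq> Pow D" using openin_subset by fastforce
  have sp: "space ?N = D" unfolding metric_borel_def by (rule space_measure_of[OF sub])
  have st: "sets ?N = sigma_sets D {U. openin mtopology U}"
    unfolding metric_borel_def by (rule sets_measure_of[OF sub])
  have Yin: "Y \<omega> \<in> D" if "\<omega> \<in> space M" for \<omega> using measurable_space[OF Y that] sp by simp
  have bound: "\<bar>(\<integral>x. f x \<partial>distr M ?N Y) - (\<integral>x. f x \<partial>return ?N z)\<bar> \<le> expectation R" if f: "f \<in> ?C" for f
  proof -
    have lip: "\<bar>f x - f y\<bar> \<le> d x y" and b: "\<bar>f x\<bar> \<le> 1" if "x \<in> D" "y \<in> D" for x y
      using f that by auto
    have fm: "f \<in> borel_measurable ?N"
    proof (rule borel_measurableI)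
      fix S :: "real set" assume S: "open S"
      have "openin mtopology (f -` S \<inter> D)"
        unfolding openin_mtopology
      proof (intro conjI ballI allI impI)
        fix x assume x: "x \<in> f -` S \<inter> D"
        then obtain r where r: "r > 0" "ball (f x) r \<subseteq> S" using S openE[of S "f x"] by auto
        have "mball x r \<subseteq> f -` S \<inter> D"
        proof
          fix y assume y: "y \<in> mball x r"
          then have "\<bar>f x - f y\<bar> < r" using lip[of x y] x by (auto simp: in_mball)
          then have "f y \<in> ball (f x) r" by (simp add: dist_real_def)
          then show "y \<in> f -` S \<inter> D" using r y by (auto simp: in_mball)
        qed
        then show "\<exists>r>0. mball x r \<subseteq> f -` S \<inter> D" using r by blast
      qed simp
      then show "f -` S \<inter> space ?N \<in> sets ?N" unfolding sp st by (intro sigma_sets.Basic) simp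
    qed
    have fY: "integrable M (\<lambda>\<omega>. f (Y \<omega>))"
      by (rule integrable_const_bound[where B = 1])
         (use measurable_compose[OF Y fm] b Yin in auto)
    have "(\<integral>x. f x \<partial>distr M ?N Y) - (\<integral>x. f x \<partial>return ?N z) = expectation (\<lambda>\<omega>. f (Y \<omega>) - f z)"
      using fY by (simp add: integral_distr[OF Y fm] integral_return[OF _ fm] sp z prob_space)
    also have "\<bar>\<dots>\<bar> \<le> expectation (\<lambda>\<omega>. \<bar>f (Y \<omega>) - f z\<bar>)" by (rule integral_abs_bound)
    also have "\<dots> \<le> expectation R"
    proof (rule integral_mono)
      show "integrable M (\<lambda>\<omega>. \<bar>f (Y \<omega>) - f z\<bar>)" using fY by simp
      show "\<bar>f (Y \<omega>) - f z\<bar> \<le> R \<omega>" if "\<omega> \<in> space M" for \<omega>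
        using lip[OF Yin[OF that] z] R(2)[OF that] by simp
    qed (rule R)
    finally show ?thesis .
  qed
  have zero: "(\<lambda>_. 0) \<in> ?C" by simp
  have "bl_dist D d (distr M ?N Y) (return ?N z) \<le> expectation R"
    unfolding bl_dist_def
  proof (rule cSUP_least)
    show "?C \<noteq> {}" by (rule ex_in_conv[THEN iffD1, OF exI, OF zero])
  qed (rule bound)
  moreover have "0 \<le> bl_dist D d (distr M ?N Y) (return ?N z)"
    unfolding bl_dist_def
  proof (rule cSUP_upper2[OF _ zero])
    show "bdd_above ((\<lambda>f. \<bar>(\<integral>x. f x \<partial>distr M ?N Y) - (\<integral>x. f x \<partial>return ?N z)\<bar>) ` ?C)"
      using bound by (intro bdd_aboveI2)
  qed simp
  ultimately show ?thesis by simp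
qed

section \<open>The scan process\<close>

text \<open>The bound is uniform in the lag and in the sample size. The weight \<open>j\<close> kills the term $j = 0$ of
  the assumed series, which is why the projection on the present enters separately, through the
  bound $2$ for the increment of a variable in $[-1, 1]$.\<close>

lemma (in prob_space) expected_lag_max_le:
  fixes X :: "int \<Rightarrow> nat \<Rightarrow> 'a \<Rightarrow> 's::polish_space"
  assumes iid: "iid_sequence M G \<epsilon>" and copy: "independent_copy M G \<epsilon> \<epsilon>'"
    and rep: "represented_by M G \<epsilon> X Xa F Fa" and X: "\<And>s T. T \<ge> 1 \<Longrightarrow> X s T \<in> borel_measurable M"
    and \<delta>: "delta0_array M F \<epsilon> \<epsilon>' X \<longlonglongrightarrow> 0"
    and h: "\<And>x y. h x y lam = exp (- lam * dist x y)" and lam: "lam \<ge> 0"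
    and T: "T \<ge> 1" and p: "p \<ge> 2"
    and C: "C \<ge> 0" "(\<Sum>j. of_nat j * (SUP t\<in>{int k + 1..int T}.
        Lp_norm M p (proj M G \<epsilon> (t - int j) (demeaned M h lam (X t T) (X (t - int k) T))))) \<le> ennreal C"
  shows "expectation (\<lambda>\<omega>. lag_max (\<lambda>t s. demeaned M h lam (X t T) (X s T) \<omega>) T k)
    \<le> 4 * (2 + sqrt 2 * C) * sqrt T"
proof -
  have \<epsilon>: "\<epsilon> s \<in> measurable M G" for s using iid by (auto simp: iid_sequence_def indep_vars_def2)
  interpret filt: int_filtered_prob_space M "past_sigma M G \<epsilon>" by (rule past_sigma_filtration[OF \<epsilon>])
  define a where "a = (\<lambda>j. SUP t\<in>{int k + 1..int T}.
    Lp_norm M p (proj M G \<epsilon> (t - int j) (demeaned M h lam (X t T) (X (t - int k) T))))"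
  define \<theta> where "\<theta> = (\<lambda>j. if j = 0 then 2 else sqrt 2 * enn2real (a j))"
  define Y where "Y = (\<lambda>i. demeaned M h lam (X (int k + 1 + int i) T) (X (1 + int i) T))"
  have kern: "0 \<le> exp (- lam * dist y z) \<and> exp (- lam * dist y z) \<le> 1" for y z :: 's
    using lam by simp
  have km: "(\<lambda>\<omega>. exp (- lam * dist (X t T \<omega>) (X s T \<omega>))) \<in> borel_measurable M" for t s
    using X[OF T, of t] X[OF T, of s] by measurable
  have Y_meas: "Y i \<in> borel_measurable M" for i
    unfolding Y_def demeaned_def h using km by simp
  have Y_bdd: "AE x in M. \<bar>Y i x\<bar> \<le> 1" for i
  proof (rule AE_I2)
    fix x
    let ?k = "\<lambda>\<omega>. exp (- lam * dist (X (int k + 1 + int i) T \<omega>) (X (1 + int i) T \<omega>))"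
    have "integrable M ?k"
      by (rule filt.integrable_bounded[where c = 1, OF km]) (use kern in \<open>simp add: abs_le_iff\<close>)
    from integral_mono[OF this, of "\<lambda>_. 1"] have "expectation ?k \<le> 1"
      using kern by (simp add: prob_space)
    moreover have "0 \<le> expectation ?k" by (intro Bochner_Integration.integral_nonneg) simp
    ultimately show "\<bar>Y i x\<bar> \<le> 1"
      unfolding Y_def demeaned_def h
      using kern[of "X (int k + 1 + int i) T x" "X (1 + int i) T x"] by linarith
  qed
  have lag: "int k + 1 + int i - int k = 1 + int i" for i by simp
  have summable_bound: "(\<Sum>j<J. of_nat j * a j) \<le> ennreal C" for J
  proof (rule order_trans[OF sum_le_suminf])
    show "(\<Sum>j. of_nat j * a j) \<le> ennreal C" unfolding a_def by (rule C(2))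
  qed auto
  have a_fin: "a j < \<top>" if "j \<ge> 1" for j
  proof -
    have "1 * a j \<le> of_nat j * a j" using that by (intro mult_right_mono) auto
    also have "\<dots> \<le> (\<Sum>j<Suc j. of_nat j * a j)" by simp
    also have "\<dots> \<le> ennreal C" by (rule summable_bound)
    finally show ?thesis by (simp add: le_less_trans)
  qed
  have \<theta>_sum: "(\<Sum>j<J. \<theta> j) \<le> 2 + sqrt 2 * C" for J
  proof -
    have "ennreal (\<Sum>j\<in>{..<J} - {0}. enn2real (a j)) = (\<Sum>j\<in>{..<J} - {0}. a j)"
      using a_fin by (subst sum_ennreal[symmetric]) (auto intro!: sum.cong)
    also have "\<dots> \<le> (\<Sum>j\<in>{..<J} - {0}. of_nat j * a j)"
    proof (rule sum_mono)
      fix j assume "j \<in> {..<J} - {0}"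
      then have "1 * a j \<le> of_nat j * a j" by (intro mult_right_mono) auto
      then show "a j \<le> of_nat j * a j" by simp
    qed
    also have "\<dots> \<le> (\<Sum>j<J. of_nat j * a j)" by (intro sum_mono2) auto
    also have "\<dots> \<le> ennreal C" by (rule summable_bound)
    finally have "(\<Sum>j\<in>{..<J} - {0}. enn2real (a j)) \<le> C" using C(1) by simp
    then have "sqrt 2 * (\<Sum>j\<in>{..<J} - {0}. enn2real (a j)) \<le> sqrt 2 * C" by simp
    moreover have "(\<Sum>j<J. \<theta> j) \<le> 2 + (\<Sum>j\<in>{..<J} - {0}. \<theta> j)"
      by (cases "J = 0") (simp_all add: sum.remove[of "{..<J}" 0] \<theta>_def)
    moreover have "(\<Sum>j\<in>{..<J} - {0}. \<theta> j) = sqrt 2 * (\<Sum>j\<in>{..<J} - {0}. enn2real (a j))"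
      unfolding sum_distrib_left by (intro sum.cong) (auto simp: \<theta>_def)
    ultimately show ?thesis by linarith
  qed
  have var: "expectation (\<lambda>x. (filt.increment (int k + 1 + int i - int j) (Y i) x)\<^sup>2) \<le> (\<theta> j)\<^sup>2"
    if i: "i < T - k" for i j
  proof (cases "j = 0")
    case True
    have "AE x in M. \<bar>filt.increment (int k + 1 + int i - int j) (Y i) x\<bar> \<le> 2"
      by (rule filt.increment_bounded[OF Y_meas Y_bdd, simplified mult_1_right])
    then have le: "AE x in M. (filt.increment (int k + 1 + int i - int j) (Y i) x)\<^sup>2 \<le> 2\<^sup>2"
      by eventually_elim (rule iffD2[OF power2_le_iff_abs_le], simp, assumption)
    have "integrable M (\<lambda>x. (filt.increment (int k + 1 + int i - int j) (Y i) x)\<^sup>2)"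
      by (rule filt.integrable_bounded[where c = "2\<^sup>2"]) (use le in simp_all)
    from integral_mono_AE[OF this _ le] show ?thesis by (simp add: True \<theta>_def prob_space)
  next
    case False
    have "Lp_norm M p (proj M G \<epsilon> (int k + 1 + int i - int j) (Y i)) \<le> a j"
      unfolding a_def by (rule SUP_upper2[of "int k + 1 + int i"]) (use i in \<open>auto simp: Y_def lag\<close>)
    also have "\<dots> = ennreal (enn2real (a j))" using a_fin[of j] False by simp
    finally have "expectation (\<lambda>x. (filt.increment (int k + 1 + int i - int j) (Y i) x)\<^sup>2)
        \<le> 2 * (enn2real (a j))\<^sup>2"
      by (intro second_moment_le_Lp_norm[where p = p, OF _ filt.increment_bounded[OF Y_meas Y_bdd] p])
         (auto simp: proj_def)
    then show ?thesis using False by (simp add: \<theta>_def power_mult_distrib)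
  qed
  have "expectation (\<lambda>x. Max ((\<lambda>n. \<bar>\<Sum>i<n. Y i x\<bar>) ` {..T - k}))
      \<le> 4 * sqrt (real (T - k)) * (2 + sqrt 2 * C)"
  proof (rule filt.projective_maximal_inequality[OF Y_meas Y_bdd _ var])
    fix i assume i: "i < T - k"
    then have t: "int k + 1 \<le> int k + 1 + int i" "int k + 1 + int i \<le> int T" by auto
    show "AE x in M. filt.cond (int k + 1 + int i) (Y i) x = Y i x"
      using demeaned_adapted[where X = X and T = T and h = h, OF \<epsilon> rep X[OF T] h lam T t]
      by (simp add: Y_def lag)
    show "(\<lambda>J. expectation (\<lambda>x. \<bar>filt.cond (int k + 1 + int i - int J) (Y i) x\<bar>)) \<longlonglongrightarrow> 0"
      using demeaned_regular[where X = X and T = T and h = h, OF iid copy rep X \<delta> h lam T t]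
      by (simp add: Y_def lag)
  qed (use \<theta>_sum in \<open>auto simp: \<theta>_def\<close>)
  also have "\<dots> \<le> 4 * sqrt T * (2 + sqrt 2 * C)"
    using C(1) by (intro mult_right_mono mult_left_mono) auto
  finally show ?thesis by (simp add: lag_max_def Y_def algebra_simps)
qed

theorem theorem3p27:
  fixes M :: "'w measure" and G :: "'g measure"
    and \<epsilon> \<epsilon>' :: "int \<Rightarrow> 'w \<Rightarrow> 'g"
    and \<iota> :: "'s::polish_space \<Rightarrow> 'h::{real_inner, complete_space}"
    and X :: "int \<Rightarrow> nat \<Rightarrow> 'w \<Rightarrow> 's" and Xa :: "int \<Rightarrow> real \<Rightarrow> 'w \<Rightarrow> 's"
    and F :: "int \<Rightarrow> nat \<Rightarrow> (nat \<Rightarrow> 'g) \<Rightarrow> 's" and Fa :: "real \<Rightarrow> (nat \<Rightarrow> 'g) \<Rightarrow> 's"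
    and h :: "'s \<Rightarrow> 's \<Rightarrow> real \<Rightarrow> real" and L\<^sub>2 :: "'s \<Rightarrow> 's \<Rightarrow> real"
    and \<Lambda> L\<^sub>1 lam e :: real and b :: "nat \<Rightarrow> real"
  assumes "prob_space M"
    and isometric: "\<And>x y. dist (\<iota> x) (\<iota> y) = dist x y"
    and "\<Lambda> > 0"
    and innovations: "iid_sequence M G \<epsilon>" "independent_copy M G \<epsilon> \<epsilon>'"
    and process: "locally_stationary M X Xa" "represented_by M G \<epsilon> X Xa F Fa"
    and delta0: "delta0_array M F \<epsilon> \<epsilon>' X \<longlonglongrightarrow> 0" "delta0_aux M Fa \<epsilon> \<epsilon>' Xa \<longlonglongrightarrow> 0"
    and i_array:
      "(SUP T\<in>{1..}. SUP l\<in>{0..\<Lambda>}. SUP k. \<Sum>j. SUP t\<in>{int k + 1..int T}.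
          nu M G \<epsilon> h l (coupled_array F \<epsilon> \<epsilon>' T) (coupled_array F \<epsilon> \<epsilon>' T) t (t - int k) j) < \<infinity>"
    and i_aux:
      "(SUP (u, v)\<in>{0..1} \<times> {0..1}. SUP l\<in>{0..\<Lambda>}. SUP k. \<Sum>j. SUP t.
          nu M G \<epsilon> h l (coupled_aux Fa \<epsilon> \<epsilon>' u) (coupled_aux Fa \<epsilon> \<epsilon>' v) t (t - int k) j) < \<infinity>"
    and ii: "e > 0"
      "(SUP T\<in>{1..}. SUP k. \<Sum>j. of_nat j * (SUP t\<in>{int k + 1..int T}.
          Lp_norm M (4 + e) (proj M G \<epsilon> (t - int j) (demeaned M h lam (X t T) (X (t - int k) T))))) < \<infinity>"
    and iii_nonneg: "\<And>x y l. l \<in> {0..\<Lambda>} \<Longrightarrow> 0 \<le> h x y l"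
    and iii_bounded: "\<exists>B. \<forall>x y. \<forall>l\<in>{0..\<Lambda>}. \<bar>h x y l\<bar> \<le> B"
    and iii_sym: "\<And>x y l. l \<in> {0..\<Lambda>} \<Longrightarrow> h x y l = h y x l"
    and iii_mono: "\<And>x y. mono_on {0..\<Lambda>} (h x y) \<or> antimono_on {0..\<Lambda>} (h x y)"
    and iii_lipschitz: "\<And>x x' y l. l \<in> {0..\<Lambda>} \<Longrightarrow> \<bar>h x y l - h x' y l\<bar> \<le> L\<^sub>1 * dist x x'"
    and iii_lipschitz_param: "\<And>x y l l'. l \<in> {0..\<Lambda>} \<Longrightarrow> l' \<in> {0..\<Lambda>} \<Longrightarrow>
          \<bar>h x y l - h x y l'\<bar> \<le> L\<^sub>2 x y * \<bar>l - l'\<bar>"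
    and iii_measurable: "(\<lambda>(x, y). L\<^sub>2 x y) \<in> borel_measurable (borel \<Otimes>\<^sub>M borel)"
    and iii_moment_array:
      "(SUP T\<in>{1..}. SUP (t, s)\<in>{1..int T} \<times> {1..int T}.
          \<integral>\<^sup>+\<omega>. ennreal ((L\<^sub>2 (X t T \<omega>) (X s T \<omega>))\<^sup>2) \<partial>M) < \<infinity>"
    and iii_moment_aux:
      "(SUP (u, v)\<in>{0..1} \<times> {0..1}. SUP (t, s)\<in>UNIV.
          \<integral>\<^sup>+\<omega>. ennreal ((L\<^sub>2 (Xa t u \<omega>) (Xa s v \<omega>))\<^sup>2) \<partial>M) < \<infinity>"
    and kernel: "lam \<in> {0<..\<Lambda>}" "\<And>x y. h x y lam = exp (- lam * dist x y)"
    and bandwidth: "b \<longlonglongrightarrow> 0" "filterlim (\<lambda>T. b T * real T) at_top sequentially"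
  shows "converges_weakly_to M
     (\<lambda>T. skorokhod_space (Qstar_section (b T))) (\<lambda>T. skorokhod_dist (Qstar_section (b T)))
     (scan_process M h lam X b) (\<lambda>T. \<lambda>u\<in>Qstar_section (b T). 0)"
proof -
  interpret prob_space M by fact
  have X: "X t T \<in> borel_measurable M" if "T \<ge> 1" for t T
    using process(1) that by (simp add: locally_stationary_def)
  have lam: "lam \<ge> 0" using kernel(1) by simp
  define D where "D = (\<lambda>T \<omega> t s. demeaned M h lam (X t T) (X s T) \<omega>)"
  define C where "C = enn2real (SUP T\<in>{1..}. SUP k. \<Sum>j. of_nat j * (SUP t\<in>{int k + 1..int T}.
    Lp_norm M (4 + e) (proj M G \<epsilon> (t - int j) (demeaned M h lam (X t T) (X (t - int k) T)))))"
  define K where "K = 4 * (2 + sqrt 2 * C)"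
  have C0: "C \<ge> 0" by (simp add: C_def)
  then have K0: "K \<ge> 0" by (simp add: K_def)
  have C: "(\<Sum>j. of_nat j * (SUP t\<in>{int k + 1..int T}.
      Lp_norm M (4 + e) (proj M G \<epsilon> (t - int j) (demeaned M h lam (X t T) (X (t - int k) T))))) \<le> ennreal C"
    if "T \<ge> 1" for T k
  proof -
    have "ennreal C = (SUP T\<in>{1..}. SUP k. \<Sum>j. of_nat j * (SUP t\<in>{int k + 1..int T}.
        Lp_norm M (4 + e) (proj M G \<epsilon> (t - int j) (demeaned M h lam (X t T) (X (t - int k) T)))))"
      unfolding C_def using ii(2) by (intro ennreal_enn2real) simp
    then show ?thesis using that by (auto intro!: SUP_upper2[of T] SUP_upper)
  qed
  have lag_mean: "expectation (\<lambda>\<omega>. lag_max (D T \<omega>) T k) \<le> K * sqrt T" if "T \<ge> 1" for T k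
    unfolding D_def K_def
    by (rule expected_lag_max_le[where h = h, OF innovations process(2) X delta0(1) kernel(2) lam that _ C0 C[OF that]])
       (use ii(1) in auto)
  have km: "(\<lambda>\<omega>. h (X t T \<omega>) (X s T \<omega>) lam) \<in> borel_measurable M" if "T \<ge> 1" for t s T
    unfolding kernel(2) using X[OF that, of t] X[OF that, of s] by measurable
  have kern: "0 \<le> h x y lam \<and> h x y lam \<le> 1" for x y
    unfolding kernel(2) using lam by simp
  have kint: "integrable M (\<lambda>\<omega>. h (X t T \<omega>) (X s T \<omega>) lam)" if "T \<ge> 1" for t s T
    by (rule integrable_const_bound[where B = 1, OF _ km[OF that]]) (use kern in \<open>simp add: abs_le_iff\<close>)
  have Dint: "integrable M (\<lambda>\<omega>. D T \<omega> t s)" if "T \<ge> 1" for t s T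
    unfolding D_def demeaned_def using kint[OF that] by simp
  have lag_int: "integrable M (\<lambda>\<omega>. lag_max (D T \<omega>) T k)" if T: "T \<ge> 1" for T k
  proof (rule Bochner_Integration.integrable_bound)
    show "integrable M (\<lambda>\<omega>. \<Sum>i<T - k. \<bar>D T \<omega> (int k + 1 + int i) (1 + int i)\<bar>)"
      using Dint[OF T] by simp
    show "(\<lambda>\<omega>. lag_max (D T \<omega>) T k) \<in> borel_measurable M"
      unfolding lag_max_def
      by (intro borel_measurable_Max borel_measurable_abs borel_measurable_sum
          borel_measurable_integrable[OF Dint[OF T]]) auto
    have "lag_max (D T \<omega>) T k \<le> (\<Sum>i<T - k. \<bar>D T \<omega> (int k + 1 + int i) (1 + int i)\<bar>)" for \<omega>
      unfolding lag_max_def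
    proof (rule Max.boundedI)
      fix x assume "x \<in> (\<lambda>n. \<bar>\<Sum>i<n. D T \<omega> (int k + 1 + int i) (1 + int i)\<bar>) ` {..T - k}"
      then obtain n where n: "n \<le> T - k" "x = \<bar>\<Sum>i<n. D T \<omega> (int k + 1 + int i) (1 + int i)\<bar>" by auto
      have "x \<le> (\<Sum>i<n. \<bar>D T \<omega> (int k + 1 + int i) (1 + int i)\<bar>)" unfolding n(2) by (rule sum_abs)
      also have "\<dots> \<le> (\<Sum>i<T - k. \<bar>D T \<omega> (int k + 1 + int i) (1 + int i)\<bar>)"
        using n(1) by (intro sum_mono2) auto
      finally show "x \<le> (\<Sum>i<T - k. \<bar>D T \<omega> (int k + 1 + int i) (1 + int i)\<bar>)" .
    qed auto
    then show "AE \<omega> in M. norm (lag_max (D T \<omega>) T k)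
        \<le> norm (\<Sum>i<T - k. \<bar>D T \<omega> (int k + 1 + int i) (1 + int i)\<bar>)"
      using lag_max_nonneg by (intro AE_I2) (simp add: sum_nonneg)
  qed
  let ?Sp = "\<lambda>T. skorokhod_space (Qstar_section (b T))" and ?di = "\<lambda>T. skorokhod_dist (Qstar_section (b T))"
  let ?z = "\<lambda>T. \<lambda>u\<in>Qstar_section (b T). 0"
  let ?bl = "\<lambda>T. bl_dist (?Sp T) (?di T) (distr M (metric_borel (?Sp T) (?di T)) (scan_process M h lam X b T))
    (return (metric_borel (?Sp T) (?di T)) (?z T))"
  have key: "?z T \<in> ?Sp T \<and> scan_process M h lam X b T \<in> M \<rightarrow>\<^sub>M metric_borel (?Sp T) (?di T)
      \<and> ?bl T \<in> {0..160 * K * b T}"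
    if bT: "b T < 1 / 2" "b T * real T \<ge> 1" for T
  proof -
    have T: "T \<ge> 1" using bT(2) by (cases T) auto
    have b0: "b T > 0"
    proof (rule ccontr)
      assume "\<not> b T > 0"
      then have "b T * real T \<le> 0" by (intro mult_nonpos_nonneg) auto
      then show False using bT by simp
    qed
    define I where "I = {b T..1 - b T}"
    have Q: "Qstar_section (b T) = I" unfolding I_def by (rule Qstar_section_eq) (use b0 in simp)
    define N where "N = \<lfloor>b T * real T\<rfloor>"
    have N: "N \<ge> 1" using bT(2) by (simp add: N_def le_floor_iff)
    define c where "c = (b T)\<^sup>2 * sqrt T / (of_int N)\<^sup>2"
    define block where "block = (\<lambda>f U. (\<Sum>t\<in>{U - N + 1..U}. \<Sum>s\<in>{U - N + 1..U}. f t s)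
      + (\<Sum>t\<in>{U + 1..U + N}. \<Sum>s\<in>{U + 1..U + N}. f t s)
      - 2 * (\<Sum>t\<in>{U - N + 1..U}. \<Sum>s\<in>{U + 1..U + N}. f t s :: real))" for f :: "int \<Rightarrow> int \<Rightarrow> real"
    define V where "V = (\<lambda>\<omega> U. c * block (D T \<omega>) U)"
    have gamma: "gamma_hat h lam X T u (b T) \<omega>
        = block (\<lambda>t s. h (X t T \<omega>) (X s T \<omega>) lam) \<lfloor>u * real T\<rfloor> / (of_int N)\<^sup>2" for u \<omega>
      by (simp add: gamma_hat_def block_def N_def Let_def)
    have mean: "expectation (gamma_hat h lam X T u (b T))
        = block (\<lambda>t s. expectation (\<lambda>\<omega>. h (X t T \<omega>) (X s T \<omega>) lam)) \<lfloor>u * real T\<rfloor> / (of_int N)\<^sup>2" for u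
      unfolding gamma[abs_def] block_def using kint[OF T] by simp
    have "(b T)\<^sup>2 * sqrt T * (gamma_hat h lam X T u (b T) \<omega> - expectation (gamma_hat h lam X T u (b T)))
        = V \<omega> \<lfloor>u * real T\<rfloor>" for u \<omega>
    proof -
      have "block (\<lambda>t s. f t s - g t s) U = block f U - block g U" for f g U
        unfolding block_def by (simp add: sum_subtractf)
      then show ?thesis
        unfolding gamma mean V_def c_def D_def demeaned_def by (simp add: diff_divide_distrib[symmetric])
    qed
    then have scan: "scan_process M h lam X b T = (\<lambda>\<omega>. floor_step T I (V \<omega>))"
      by (simp add: scan_process_def floor_step_def Q fun_eq_iff)
    have z: "(\<lambda>u\<in>I. 0) = floor_step T I (\<lambda>_. 0)" by (simp add: floor_step_def)
    have ab: "b T \<le> 1 - b T" using bT(1) by simp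
    have T0: "real T > 0" using T by simp
    have Vm: "(\<lambda>\<omega>. V \<omega> i) \<in> borel_measurable M" for i
      unfolding V_def block_def using borel_measurable_integrable[OF Dint[OF T]] by measurable
    have zin: "?z T \<in> ?Sp T" unfolding Q z by (rule floor_step_skorokhod[OF T0])
    have meas: "scan_process M h lam X b T \<in> M \<rightarrow>\<^sub>M metric_borel (?Sp T) (?di T)"
      unfolding scan Q I_def by (rule floor_step_measurable[OF ab T0 Vm])
    \<comment> \<open>The factor 8: the statistic has four rectangles, as the cross term counts twice, and each is
      at most twice the sum of the lag maxima. The lags range over $[-N, N]$ for the squares and
      over $[-2N, 0]$ for the cross term, so $[-2N, 2N]$ covers all of them.\<close>
    define R where "R = (\<lambda>\<omega>. 8 * c * (\<Sum>l\<in>{- 2 * N..2 * N}. lag_max (D T \<omega>) T (nat \<bar>l\<bar>)))"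
    have c0: "c \<ge> 0" by (simp add: c_def)
    have V_le: "\<bar>V \<omega> \<lfloor>u * real T\<rfloor>\<bar> \<le> R \<omega>" if u: "u \<in> I" for u \<omega>
    proof -
      define U where "U = \<lfloor>u * real T\<rfloor>"
      let ?L = "\<Sum>l\<in>{- 2 * N..2 * N}. lag_max (D T \<omega>) T (nat \<bar>l\<bar>)"
      \<comment> \<open>The range of \<open>u\<close> keeps both windows inside the sample, where the representation and the
        moment condition are available.\<close>
      have "b T * real T \<le> u * real T" using u by (simp add: I_def mult_right_mono)
      then have U1: "0 \<le> U - N" unfolding N_def U_def by (simp add: floor_mono)
      have "u * real T + b T * real T \<le> 1 * real T"
        unfolding distrib_right[symmetric] using u by (intro mult_right_mono) (auto simp: I_def)
      then have U2: "U + N \<le> int T" unfolding N_def U_def by linarith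
      have sym: "D T \<omega> t s = D T \<omega> s t" for t s
        by (simp add: D_def demeaned_def kernel(2) dist_commute)
      note rect = rectangle_sum_le_lag_max[where D = "D T \<omega>" and N = N and E = "{- 2 * N..2 * N}", OF sym]
      have "\<bar>\<Sum>t\<in>{U - N + 1..U}. \<Sum>s\<in>{U - N + 1..U}. D T \<omega> t s\<bar> \<le> 2 * ?L"
        using rect[of "U - N" T "U - N"] U1 U2 N by simp
      moreover have "\<bar>\<Sum>t\<in>{U + 1..U + N}. \<Sum>s\<in>{U + 1..U + N}. D T \<omega> t s\<bar> \<le> 2 * ?L"
        using rect[of U T U] U1 U2 N by simp
      moreover have "\<bar>\<Sum>t\<in>{U - N + 1..U}. \<Sum>s\<in>{U + 1..U + N}. D T \<omega> t s\<bar> \<le> 2 * ?L"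
        using rect[of "U - N" T U] U1 U2 N by simp
      ultimately have "\<bar>block (D T \<omega>) U\<bar> \<le> 8 * ?L"
        unfolding block_def by linarith
      then have "c * \<bar>block (D T \<omega>) U\<bar> \<le> c * (8 * ?L)" using c0 by (rule mult_left_mono)
      then show ?thesis using c0 by (simp add: V_def R_def U_def abs_mult mult_ac)
    qed
    have R_int: "integrable M R" unfolding R_def using lag_int[OF T] by simp
    have "expectation R = 8 * c * (\<Sum>l\<in>{- 2 * N..2 * N}. expectation (\<lambda>\<omega>. lag_max (D T \<omega>) T (nat \<bar>l\<bar>)))"
      unfolding R_def using lag_int[OF T] by simp
    also have "\<dots> \<le> 8 * c * (\<Sum>l\<in>{- 2 * N..2 * N}. K * sqrt T)"
      using c0 by (intro mult_left_mono sum_mono lag_mean T) auto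
    also have "\<dots> = 8 * c * (of_int (4 * N + 1) * (K * sqrt T))" using N by simp
    also have "\<dots> \<le> 8 * c * (of_int (5 * N) * (K * sqrt T))"
      using c0 K0 N by (intro mult_left_mono mult_right_mono) auto
    also have "\<dots> = 40 * K * b T * (b T * real T / of_int N)"
      using N by (simp add: c_def power2_eq_square field_simps)
    also have "\<dots> \<le> 40 * K * b T * 4"
    proof (intro mult_left_mono)
      have "b T * real T \<le> of_int N + 1" unfolding N_def by linarith
      also have "\<dots> \<le> 4 * of_int N" using N by simp
      finally show "b T * real T / of_int N \<le> 4" using N by (simp add: divide_le_eq)
    qed (use K0 b0 in auto)
    finally have ER: "expectation R \<le> 160 * K * b T" by simp
    have "?bl T \<in> {0..expectation R}"
    proof (rule bl_dist_return_le[OF _ meas zin R_int])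
      show "Metric_space (?Sp T) (?di T)" unfolding Q I_def by (rule Metric_space_skorokhod[OF ab])
      show "?di T (scan_process M h lam X b T \<omega>) (?z T) \<le> R \<omega>" for \<omega>
        unfolding scan Q z unfolding I_def
        by (rule skorokhod_dist_le_sup_dist[OF ab floor_step_skorokhod[OF T0] floor_step_skorokhod[OF T0]])
           (use V_le in \<open>simp add: floor_step_def I_def\<close>)
    qed
    then show ?thesis using ER zin meas by auto
  qed
  have ev: "\<forall>\<^sub>F T in sequentially. b T < 1 / 2 \<and> b T * real T \<ge> 1"
    using order_tendstoD(2)[OF bandwidth(1), of "1 / 2"] bandwidth(2)
    by (auto simp: filterlim_at_top eventually_conj_iff)
  show ?thesis
    unfolding converges_weakly_to_def
  proof (intro conjI)
    show "\<forall>\<^sub>F T in sequentially. ?z T \<in> ?Sp T \<and> scan_process M h lam X b T \<in> M \<rightarrow>\<^sub>M metric_borel (?Sp T) (?di T)"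
      using ev by eventually_elim (use key in blast)
    have lim: "(\<lambda>T. 160 * K * b T) \<longlonglongrightarrow> 0"
      using tendsto_mult_right_zero[OF bandwidth(1)] by blast
    show "?bl \<longlonglongrightarrow> 0"
    proof (rule tendsto_sandwich[OF _ _ tendsto_const lim])
      show "\<forall>\<^sub>F T in sequentially. 0 \<le> ?bl T" using ev by eventually_elim (use key in simp)
      show "\<forall>\<^sub>F T in sequentially. ?bl T \<le> 160 * K * b T" using ev by eventually_elim (use key in simp)
    qed
  qed
qed

end
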